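(* Fix $c>1$ and let $d=\omega(\log n)$. Consider any list-of-points data structure for $(c,r)$-ANN on Hamming random instances of $n$ points in $\{0,1\}^d$ that achieves total space $n^{1+\rho_u+o(1)}$ and has query time $n^{\rho_q-o(1)}$, with success probability $2/3$. Then $$c\sqrt{\rho_q}+(c-1)\sqrt{\rho_u}\ \ge\ \sqrt{2c-1}.$$
   Context: List-of-points data structure: fix (possibly randomly, independently of the dataset) sets $A_1,\dots,A_m\subseteq\{0,1\}^d$, and associate with each possible query $q\in\{0,1\}^d$ a (random) set of indices $I(q)\subseteq[m]$. Given a dataset $P$, the structure stores the lists $L_i=P\cap A_i$, $i=1,\dots,m$. On query $q$ it scans each list $L_i$ with $i\in I(q)$ and returns some $p\in L_i$ with $\|p-q\|_1\le cr$ if one exists. Total space is $s=m+\sum_{i=1}^m|L_i|$ and query time is $t=|I(q)|+\sum_{i\in I(q)}|L_i|$. Hamming random instance: $n$ independent uniform points of the hypercube form $P$; a query is obtained from a uniformly random $p\in P$ by flipping each coordinate independently with probability $\frac1{2c}$ (so it is within distance $r\approx\frac d{2c}$ of $p$ and, w.h.p., at distance about $\frac d2>cr$ from all other points). $(c,r)$-ANN: given $q$ having a data point within distance $r$, return a data point within distance $cr$. *)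

theory Defs
  imports "HOL-Probability.Probability" "HOL-Library.Landau_Symbols"
begin

text \<open>Points of the hypercube \<open>{0,1}\<^sup>d\<close> are Boolean lists, so that \<open>d\<close> can vary with \<open>n\<close>.\<close>

definition cube :: "nat \<Rightarrow> bool list set" where
  "cube d = {x. length x = d}"

definition l1_dist :: "bool list \<Rightarrow> bool list \<Rightarrow> real" where
  "l1_dist x y = (\<Sum>i<length x. \<bar>of_bool (x ! i) - of_bool (y ! i)\<bar>)"

text \<open>
  One realization of the internal randomness of a list-of-points data structure: the sets
  \<open>A\<^sub>1, \<dots>, A\<^sub>m\<close>, indexed from 0 here, and the map \<open>q \<mapsto> I(q)\<close>. A randomized structure is a pmf on
  such realizations. The joint law of the sets and of \<open>I\<close> is arbitrary, and \<open>m\<close> may be random.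
  Nothing is lost by discreteness, since only countably many realizations differ on the cube.
\<close>

record list_of_points =
  regions :: "bool list set list"
  probes :: "bool list \<Rightarrow> nat set"

definition structures :: "nat \<Rightarrow> list_of_points set" where
  "structures d = {D. (\<forall>A \<in> set (regions D). A \<subseteq> cube d) \<and>
                      (\<forall>q \<in> cube d. probes D q \<subseteq> {..<length (regions D)})}"

definition stored :: "list_of_points \<Rightarrow> bool list set \<Rightarrow> nat \<Rightarrow> bool list set" where
  "stored D P i = P \<inter> regions D ! i"

definition total_space :: "list_of_points \<Rightarrow> bool list set \<Rightarrow> nat" where
  "total_space D P = length (regions D) + (\<Sum>i<length (regions D). card (stored D P i))"

definition query_time :: "list_of_points \<Rightarrow> bool list set \<Rightarrow> bool list \<Rightarrow> nat" where
  "query_time D P q = card (probes D q) + (\<Sum>i\<in>probes D q. card (stored D P i))"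

text \<open>The scan on query \<open>q\<close> finds a data point within distance \<open>R\<close> (with \<open>R = c r\<close> for ANN).\<close>

definition succeeds :: "real \<Rightarrow> list_of_points \<Rightarrow> bool list set \<Rightarrow> bool list \<Rightarrow> bool" where
  "succeeds R D P q \<longleftrightarrow> (\<exists>i \<in> probes D q. \<exists>p \<in> stored D P i. l1_dist p q \<le> R)"

text \<open>
  A Hamming random instance \<open>(ps, j, q)\<close>: the data points \<open>ps\<close> in order of sampling, the index \<open>j\<close>
  of the point from which the query is generated, and the query \<open>q\<close>. Meaningful for \<open>n > 0\<close>.
\<close>

definition random_instance :: "real \<Rightarrow> nat \<Rightarrow> nat \<Rightarrow> (bool list list \<times> nat \<times> bool list) pmf" where
  "random_instance c n d =
     do {
       ps \<leftarrow> replicate_pmf n (pmf_of_set (cube d));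
       j \<leftarrow> pmf_of_set {..<n};
       flips \<leftarrow> replicate_pmf d (bernoulli_pmf (1 / (2 * c)));
       return_pmf (ps, j, map2 (\<noteq>) (ps ! j) flips)
     }"

text \<open>
  The radius \<open>r\<close> is about \<open>d / (2c)\<close>, and with high probability all data points other than the
  one from which \<open>q\<close> is generated are at distance more than \<open>c r\<close> from \<open>q\<close>. The asymptotic equality
  alone does not give the second property: \<open>c r\<close> must lie below \<open>d / 2\<close> by a lower-order margin,
  as otherwise an arbitrary data point would be a correct answer with constant probability. For
  \<open>d = \<omega>(log n)\<close> such a margin exists, e.g. \<open>r = (1 - (ln n / d) powr (1/3)) d / (2c)\<close>.
\<close>

definition instance_radius :: "real \<Rightarrow> (nat \<Rightarrow> nat) \<Rightarrow> (nat \<Rightarrow> real) \<Rightarrow> bool" where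
  "instance_radius c d r \<longleftrightarrow>
     r \<sim>[at_top] (\<lambda>n. real (d n) / (2 * c)) \<and>
     (\<lambda>n. measure_pmf.prob (random_instance c n (d n))
            {(ps, j, q). \<forall>k<n. k \<noteq> j \<longrightarrow> l1_dist (ps ! k) q > c * r n}) \<longlonglongrightarrow> 1"

text \<open>
  Space and time are taken in expectation over the structure and the instance, as extended
  nonnegative integrals, so that an infinite expectation cannot count as a small one.
  Pairing expresses that the structure is independent of the instance.
\<close>

definition expected_space :: "list_of_points pmf \<Rightarrow> real \<Rightarrow> nat \<Rightarrow> nat \<Rightarrow> ennreal" where
  "expected_space S c n d =
     (\<integral>\<^sup>+ (D, ps, j, q). of_nat (total_space D (set ps))
        \<partial>measure_pmf (pair_pmf S (random_instance c n d)))"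

definition expected_query_time :: "list_of_points pmf \<Rightarrow> real \<Rightarrow> nat \<Rightarrow> nat \<Rightarrow> ennreal" where
  "expected_query_time S c n d =
     (\<integral>\<^sup>+ (D, ps, j, q). of_nat (query_time D (set ps) q)
        \<partial>measure_pmf (pair_pmf S (random_instance c n d)))"

definition success_prob :: "list_of_points pmf \<Rightarrow> real \<Rightarrow> nat \<Rightarrow> nat \<Rightarrow> real \<Rightarrow> real" where
  "success_prob S c n d r =
     measure_pmf.prob (pair_pmf S (random_instance c n d))
       {(D, ps, j, q). succeeds (c * r) D (set ps) q}"

end

theory Submission imports Defs begin

text \<open>
  A uniform point and its noisy copy have correlation \<open>\<sigma> = 1 - 1/c\<close> in each coordinate, so
  two-function hypercontractivity bounds the probability that the data point lies in \<open>A\<close> and the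
  query in \<open>B\<close> by \<open>a\<^bsup>1/p\<^esup> b\<^bsup>1/q\<^esup>\<close>, where \<open>a\<close>, \<open>b\<close> are the densities of \<open>A\<close>, \<open>B\<close> and
  \<open>(p - 1)(q - 1) = \<sigma>\<^sup>2\<close>. Apply this to each list, with \<open>B\<close> the set of queries that scan it. Up to
  constants, the list costs \<open>s = 1 + n a\<close> in space and \<open>b s\<close> in time, and
  \<open>a\<^bsup>1/p\<^esup> b\<^bsup>1/q\<^esup> \<le> n\<^bsup>-1/p\<^esup> s\<^bsup>1-1/q\<^esup> (b s)\<^bsup>1/q\<^esup>\<close>. Summing by weighted AM-GM, constant success
  probability forces \<open>1/p \<le> (1 + \<rho>\<^sub>u)(1 - 1/q) + \<rho>\<^sub>q/q\<close>, that is,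
  \<open>y (1 - \<sigma>\<^sup>2) / (y + \<sigma>\<^sup>2) \<le> \<rho>\<^sub>u y + \<rho>\<^sub>q\<close> with \<open>y = q - 1\<close> arbitrary, and the theorem is the
  optimum over \<open>y\<close>.

  The two-point case of hypercontractivity reduces to exponents in \<open>(1, 2]\<close>, where the binomial
  series of \<open>((1 + s)\<^sup>p + (1 - s)\<^sup>p) / 2\<close> has nonnegative terms and can be compared termwise.
\<close>

section \<open>The two-point inequality\<close>

definition even_mean :: "real \<Rightarrow> real \<Rightarrow> real" where
  "even_mean p s = ((1 + s) powr p + (1 - s) powr p) / 2"

text \<open>For \<open>\<bar>s\<bar> \<le> 1\<close> this is the L^p norm, under the uniform
  measure, of the function \<open>1 + s x\<close> on x = 1, -1. Up to scaling these are all the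
  nonzero nonnegative functions on two points.\<close>

definition power_mean :: "real \<Rightarrow> real \<Rightarrow> real" where
  "power_mean p s = even_mean p s powr (1 / p)"

section \<open>Binomial series and contraction for exponents up to 2\<close>

lemma even_binomial_series:
  assumes "\<bar>s\<bar> < 1"
  shows "(\<lambda>k. (a gchoose (2 * k)) * s ^ (2 * k)) sums even_mean a s"
proof -
  have "(\<lambda>n. ((a gchoose n) * s ^ n + (a gchoose n) * (- s) ^ n) / 2)
      sums (((1 + s) powr a + (1 + - s) powr a) / 2)"
    by (intro sums_divide sums_add gen_binomial_real) (use assms in auto)
  moreover have "((a gchoose n) * s ^ n + (a gchoose n) * (- s) ^ n) / 2 = 0"
    if "n \<notin> range (\<lambda>k. 2 * k)" for n
  proof -
    have "odd n" using that by (auto elim: evenE)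
    then show ?thesis by simp
  qed
  ultimately have "(\<lambda>k. ((a gchoose (2 * k)) * s ^ (2 * k) + (a gchoose (2 * k)) * (- s) ^ (2 * k)) / 2)
      sums (((1 + s) powr a + (1 + - s) powr a) / 2)"
    by (subst sums_mono_reindex[of "\<lambda>k. 2 * k"]) (auto simp: strict_mono_def)
  then show ?thesis by (simp add: power_mult even_mean_def)
qed

text \<open>Both factors of the numerator have their sign reversed, so that they are visibly
  nonnegative for \<open>a \<le> 2\<close> and \<open>k \<ge> 1\<close>.\<close>

lemma gbinomial_double_Suc:
  fixes a :: real
  shows "(a gchoose (2 * Suc k)) =
    (a gchoose (2 * k)) * ((2 * real k - a) * (2 * real k + 1 - a) / ((2 * real k + 1) * (2 * real k + 2)))"
proof -
  have step: "(a gchoose Suc m) = (a gchoose m) * ((a - real m) / (real m + 1))" for m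
    by (simp add: gbinomial_prod_rev field_simps)
  have "(a gchoose (2 * Suc k)) = (a gchoose (2 * k)) *
      (((a - 2 * real k) * (a - (2 * real k + 1))) / ((2 * real k + 1) * (2 * real k + 2)))"
    using step[of "2 * k"] step[of "Suc (2 * k)"] by (simp add: add.commute)
  also have "(a - 2 * real k) * (a - (2 * real k + 1)) = (2 * real k - a) * (2 * real k + 1 - a)"
    by (simp add: algebra_simps)
  finally show ?thesis by simp
qed

lemma contraction_factor_le_1:
  fixes p r \<sigma> :: real
  assumes "1 < p" "p \<le> r" "\<sigma>\<^sup>2 * (r - 1) = p - 1"
  shows "\<sigma>\<^sup>2 \<le> 1"
proof -
  have "\<sigma>\<^sup>2 = (p - 1) / (r - 1)" using assms by (simp add: field_simps)
  also have "\<dots> \<le> 1" using assms by simp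
  finally show ?thesis .
qed

text \<open>At \<open>k = 1\<close> the relation between \<sigma>, \<open>p\<close> and
  \<open>r\<close> makes the comparison an equality. From \<open>k\<close> to \<open>k + 1\<close>
  each coefficient gains a ratio that decreases in the exponent on the range up to 2, and the left
  side gains a further factor \<open>\<sigma>\<^sup>2 \<le> 1\<close>, so the comparison
  persists.\<close>

lemma even_gbinomial_le:
  fixes p r \<sigma> :: real
  assumes "1 < p" "p \<le> r" "r \<le> 2" "\<sigma>\<^sup>2 * (r - 1) = p - 1" "k \<ge> 1"
  shows "0 \<le> (p gchoose (2 * k)) \<and> 0 \<le> (r gchoose (2 * k)) \<and>
    (r gchoose (2 * k)) * \<sigma> ^ (2 * k) \<le> (r / p) * (p gchoose (2 * k))"
  using \<open>k \<ge> 1\<close>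
proof (induction k rule: dec_induct)
  case base
  have 2: "(a gchoose (2 * 1)) = a * (a - 1) / 2" for a :: real
    using gbinomial_double_Suc[of a 0] by (simp add: algebra_simps)
  have "r * (r - 1) / 2 * \<sigma> ^ (2 * 1) = r * (\<sigma>\<^sup>2 * (r - 1)) / 2"
    by simp
  also have "\<dots> = (r / p) * (p * (p - 1) / 2)"
    unfolding assms(4) using assms(1) by simp
  finally have eq: "r * (r - 1) / 2 * \<sigma> ^ (2 * 1) = (r / p) * (p * (p - 1) / 2)" .
  have "0 \<le> p * (p - 1) / 2" "0 \<le> r * (r - 1) / 2"
    using assms(1,2) by simp_all
  then show ?case
    unfolding 2 using eq by (metis order_refl)
next
  case (step k)
  have s1: "\<sigma>\<^sup>2 \<le> 1" using assms by (intro contraction_factor_le_1)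
  define g where "g a = (2 * real k - a) * (2 * real k + 1 - a) / ((2 * real k + 1) * (2 * real k + 2))" for a
  have k: "real k \<ge> 1" using step.hyps by simp
  have g0: "0 \<le> g r" "0 \<le> g p" unfolding g_def
    using assms k by (auto intro!: divide_nonneg_nonneg mult_nonneg_nonneg)
  have g1: "g r \<le> g p" unfolding g_def
    using assms k by (intro divide_right_mono mult_mono) auto
  have "(r gchoose (2 * k)) * g r * \<sigma> ^ (2 * Suc k)
      = (\<sigma>\<^sup>2 * g r) * ((r gchoose (2 * k)) * \<sigma> ^ (2 * k))"
    by (simp add: power2_eq_square)
  also have "\<dots> \<le> (1 * g p) * ((r / p) * (p gchoose (2 * k)))"
  proof (rule mult_mono)
    show "\<sigma>\<^sup>2 * g r \<le> 1 * g p" using s1 g0 g1 by (intro mult_mono) auto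
  qed (use step.IH g0 in \<open>auto intro!: mult_nonneg_nonneg zero_le_even_power'\<close>)
  finally show ?case
    unfolding gbinomial_double_Suc g_def[symmetric] using step.IH g0 by (simp add: mult_ac)
qed

text \<open>Weighted AM-GM: \<open>1 + t\<close> is the geometric mean of
  \<open>(1 + t) powr p\<close> and 1 with weights \<open>1 / p\<close> and
  \<open>1 - 1 / p\<close>. The endpoint \<open>t = -1\<close>, where a base vanishes, is
  separate.\<close>

lemma Bernoulli_powr:
  fixes p t :: real
  assumes "1 \<le> p" "-1 \<le> t"
  shows "1 + p * t \<le> (1 + t) powr p"
proof (cases "t = -1")
  case False
  have "((1 + t) powr p) powr (1 / p) * 1 powr (1 - 1 / p) \<le> 1 / p * (1 + t) powr p + (1 - 1 / p) * 1"
    by (rule Youngs_inequality_0) (use assms False in auto)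
  then have "p * (1 + t) \<le> p * (1 / p * (1 + t) powr p + (1 - 1 / p))"
    using assms by (simp add: powr_powr)
  also have "\<dots> = (1 + t) powr p + (p - 1)"
    using assms by (simp add: field_simps)
  finally show ?thesis by (simp add: algebra_simps)
qed (use assms in simp)

lemma even_mean_ge_1:
  assumes "1 \<le> p" "\<bar>s\<bar> \<le> 1"
  shows "1 \<le> even_mean p s"
  using Bernoulli_powr[of p s] Bernoulli_powr[of p "- s"] assms by (simp add: even_mean_def abs_le_iff)

text \<open>Termwise comparison gives \<open>even_mean r (\<sigma> * s) - 1 \<le> (r / p) *
  (even_mean p s - 1)\<close>, and Bernoulli with exponent \<open>r / p \<ge> 1\<close> turns the
  right side into a power.\<close>

lemma even_mean_contraction_open:
  assumes "1 < p" "p \<le> r" "r \<le> 2" "\<sigma>\<^sup>2 * (r - 1) = p - 1" "\<bar>s\<bar> < 1"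
  shows "even_mean r (\<sigma> * s) \<le> even_mean p s powr (r / p)"
proof -
  have "\<sigma>\<^sup>2 \<le> 1" using assms by (intro contraction_factor_le_1)
  then have "\<bar>\<sigma>\<bar> \<le> 1" by (simp add: abs_square_le_1)
  then have "\<bar>\<sigma> * s\<bar> < 1"
    using assms mult_mono[of "\<bar>\<sigma>\<bar>" 1 "\<bar>s\<bar>" "\<bar>s\<bar>"] by (simp add: abs_mult)
  note sums_r = even_binomial_series[OF this, of r]
  \<comment> \<open>Scaling by \<open>r / p\<close> changes the constant term from 1 to
    \<open>r / p\<close>; the extra summand at \<open>k = 0\<close> restores it, so that both series
    start with 1.\<close>
  have sums_p: "(\<lambda>k. (r / p) * ((p gchoose (2 * k)) * s ^ (2 * k)) + (if k = 0 then 1 - r / p else 0))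
      sums ((r / p) * even_mean p s + (1 - r / p))"
    using sums_single[of 0 "\<lambda>_. 1 - r / p"]
    by (intro sums_add sums_mult even_binomial_series assms) (simp_all add: eq_commute)
  have "even_mean r (\<sigma> * s) \<le> (r / p) * even_mean p s + (1 - r / p)"
  proof (rule sums_le[OF _ sums_r sums_p])
    fix k
    show "(r gchoose (2 * k)) * (\<sigma> * s) ^ (2 * k)
        \<le> (r / p) * ((p gchoose (2 * k)) * s ^ (2 * k)) + (if k = 0 then 1 - r / p else 0)"
    proof (cases "k = 0")
      case False
      then have "(r gchoose (2 * k)) * \<sigma> ^ (2 * k) \<le> (r / p) * (p gchoose (2 * k))"
        using even_gbinomial_le[of p r \<sigma> k] assms by auto
      then have "(r gchoose (2 * k)) * \<sigma> ^ (2 * k) * s ^ (2 * k) \<le> (r / p) * (p gchoose (2 * k)) * s ^ (2 * k)"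
        by (intro mult_right_mono zero_le_even_power')
      with False show ?thesis
        by (simp add: power_mult_distrib mult.assoc)
    qed simp
  qed
  also have "\<dots> = 1 + (r / p) * (even_mean p s - 1)"
    by (simp add: algebra_simps)
  also have "\<dots> \<le> (1 + (even_mean p s - 1)) powr (r / p)"
    using assms even_mean_ge_1[of p s] by (intro Bernoulli_powr) auto
  finally show ?thesis by simp
qed

text \<open>The series is available for \<open>\<bar>s\<bar> < 1\<close>. The endpoints, which
  correspond to functions vanishing at one of the two points, follow by continuity.\<close>

lemma even_mean_contraction:
  assumes "1 < p" "p \<le> r" "r \<le> 2" "\<sigma>\<^sup>2 * (r - 1) = p - 1" "\<bar>s\<bar> \<le> 1"
  shows "even_mean r (\<sigma> * s) \<le> even_mean p s powr (r / p)"
proof -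
  define t where "t n = s * (1 - inverse (real (Suc n)))" for n
  have lim: "t \<longlonglongrightarrow> s"
    using tendsto_mult[OF tendsto_const[of s] tendsto_diff[OF tendsto_const LIMSEQ_inverse_real_of_nat, of 1]]
    by (simp add: t_def[abs_def])
  have t1: "\<bar>t n\<bar> < 1" for n
  proof -
    have "\<bar>t n\<bar> = \<bar>s\<bar> * (1 - inverse (real (Suc n)))"
      by (simp add: t_def abs_mult inverse_eq_divide)
    also have "\<dots> \<le> 1 * (1 - inverse (real (Suc n)))"
      using assms by (intro mult_right_mono) (auto simp: inverse_eq_divide)
    also have "\<dots> < 1" by simp
    finally show ?thesis .
  qed
  \<comment> \<open>At an endpoint one of the bases is 0, where \<open>powr\<close> is continuous
    along nonnegative bases for a positive exponent.\<close>
  have cont: "(\<lambda>n. even_mean q (u n)) \<longlonglongrightarrow> even_mean q x"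
    if "u \<longlonglongrightarrow> x" "q > 0" "\<bar>x\<bar> \<le> 1" "\<And>n. \<bar>u n\<bar> \<le> 1" for q u and x :: real
    unfolding even_mean_def using that
    by (intro tendsto_intros tendsto_powr2 that) (auto simp: abs_le_iff intro!: always_eventually, (smt (verit))+)
  have "\<sigma>\<^sup>2 \<le> 1" using assms by (intro contraction_factor_le_1)
  then have "\<bar>\<sigma>\<bar> \<le> 1" by (simp add: abs_square_le_1)
  then have le: "\<bar>\<sigma> * x\<bar> \<le> 1" if "\<bar>x\<bar> \<le> 1" for x
    using that mult_mono[of "\<bar>\<sigma>\<bar>" 1 "\<bar>x\<bar>" 1] by (simp add: abs_mult)
  have "(\<lambda>n. even_mean r (\<sigma> * t n)) \<longlonglongrightarrow> even_mean r (\<sigma> * s)"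
    using assms t1 lim by (intro cont le tendsto_intros) (auto intro: less_imp_le)
  moreover have "(\<lambda>n. even_mean p (t n) powr (r / p)) \<longlonglongrightarrow> even_mean p s powr (r / p)"
    using assms t1 lim even_mean_ge_1[of p s]
    by (intro tendsto_powr cont tendsto_const) (auto intro: less_imp_le)
  moreover have "even_mean r (\<sigma> * t n) \<le> even_mean p (t n) powr (r / p)" for n
    using assms t1 by (intro even_mean_contraction_open) auto
  ultimately show ?thesis
    by (intro LIMSEQ_le) auto
qed

text \<open>Hypercontractivity from L^p to L^r, with \<open>r \<le> 2\<close>, of the noise operator
  on one bit, which sends \<open>1 + s x\<close> to \<open>1 + \<sigma> s x\<close>.\<close>

lemma power_mean_contraction:
  assumes "1 < p" "p \<le> r" "r \<le> 2" "\<sigma>\<^sup>2 * (r - 1) = p - 1" "\<bar>s\<bar> \<le> 1"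
  shows "power_mean r (\<sigma> * s) \<le> power_mean p s"
proof -
  have "0 \<le> even_mean r (\<sigma> * s)" by (simp add: even_mean_def)
  then have "even_mean r (\<sigma> * s) powr (1 / r) \<le> (even_mean p s powr (r / p)) powr (1 / r)"
    using assms by (intro powr_mono2 even_mean_contraction) auto
  then show ?thesis using assms by (simp add: power_mean_def powr_powr)
qed

section \<open>Two-function hypercontractivity on two points\<close>

lemma power_mean_2:
  assumes "\<bar>s\<bar> \<le> 1"
  shows "power_mean 2 s = sqrt (1 + s\<^sup>2)"
proof -
  have "even_mean 2 s = 1 + s\<^sup>2"
    using assms by (simp add: even_mean_def abs_le_iff power2_eq_square algebra_simps)
  then show ?thesis by (simp add: power_mean_def powr_half_sqrt)
qed

text \<open>The noise is shared out as \<open>\<sigma> = \<alpha> * \<beta>\<close>, with \<alpha>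
  contracting L^p to L^2 and \<beta> contracting L^q to L^2; Cauchy-Schwarz in L^2 joins the
  two.\<close>

lemma two_point_le_2:
  assumes "1 < p" "p \<le> 2" "1 < q" "q \<le> 2" "(p - 1) * (q - 1) = \<sigma>\<^sup>2" "0 \<le> \<sigma>" "\<bar>s\<bar> \<le> 1" "\<bar>t\<bar> \<le> 1"
  shows "1 + \<sigma> * s * t \<le> power_mean p s * power_mean q t"
proof -
  define \<alpha> \<beta> where "\<alpha> = sqrt (p - 1)" and "\<beta> = sqrt (q - 1)"
  have ab: "0 \<le> \<alpha>" "\<alpha> \<le> 1" "0 \<le> \<beta>" "\<beta> \<le> 1" "\<alpha>\<^sup>2 = p - 1" "\<beta>\<^sup>2 = q - 1"
    using assms by (auto simp: \<alpha>_def \<beta>_def)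
  have "\<sigma> = \<alpha> * \<beta>"
    using assms unfolding \<alpha>_def \<beta>_def
    by (simp flip: real_sqrt_mult)
  then have "1 + \<sigma> * s * t = 1 * 1 + (\<alpha> * s) * (\<beta> * t)" by simp
  also have "\<dots> \<le> sqrt (1\<^sup>2 + (\<alpha> * s)\<^sup>2) * sqrt (1\<^sup>2 + (\<beta> * t)\<^sup>2)"
  proof -
    have "(1 * 1 + (\<alpha> * s) * (\<beta> * t))\<^sup>2 \<le> (1\<^sup>2 + (\<alpha> * s)\<^sup>2) * (1\<^sup>2 + (\<beta> * t)\<^sup>2)"
      using zero_le_power2[of "\<alpha> * s - \<beta> * t"] by (simp add: power2_eq_square algebra_simps)
    then show ?thesis by (simp flip: real_sqrt_mult add: real_le_rsqrt)
  qed
  also have "\<dots> = power_mean 2 (\<alpha> * s) * power_mean 2 (\<beta> * t)"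
    using ab assms mult_mono[of \<alpha> 1 "\<bar>s\<bar>" 1] mult_mono[of \<beta> 1 "\<bar>t\<bar>" 1]
    by (subst (1 2) power_mean_2) (auto simp: abs_mult)
  also have "\<dots> \<le> power_mean p s * power_mean q t"
    using ab assms by (intro mult_mono power_mean_contraction) (auto simp: power_mean_def)
  finally show ?thesis .
qed

text \<open>Young's inequality at each of the two points, after dividing both functions by their
  norms.\<close>

lemma Holder_two_point:
  fixes a b u v p q :: real
  assumes "1 < p" "1 < q" "1 / p + 1 / q = 1" "0 \<le> a" "0 \<le> b" "0 \<le> u" "0 \<le> v"
  shows "(a * u + b * v) / 2 \<le> ((a powr p + b powr p) / 2) powr (1 / p) * ((u powr q + v powr q) / 2) powr (1 / q)"
proof (cases "(a powr p + b powr p) / 2 > 0 \<and> (u powr q + v powr q) / 2 > 0")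
  case True
  define m where "m = ((a powr p + b powr p) / 2) powr (1 / p)"
  define k where "k = ((u powr q + v powr q) / 2) powr (1 / q)"
  have mk: "m > 0" "k > 0" "m powr p = (a powr p + b powr p) / 2" "k powr q = (u powr q + v powr q) / 2"
    using True assms by (auto simp: m_def k_def powr_powr)
  \<comment> \<open>Dividing by the norm makes the two powers average to 1, so they sum to
    2.\<close>
  have norm: "(x / X) / r + (y / X) / r = 2 * (1 / r)" if "X = (x + y) / 2" "X > 0" for x y X r :: real
  proof -
    have "(x / X) / r + (y / X) / r = ((x + y) / X) / r" by (simp add: add_divide_distrib)
    also have "(x + y) / X = 2" using that by (simp add: field_simps)
    finally show ?thesis by simp
  qed
  have "(a / m) * (u / k) + (b / m) * (v / k)
      \<le> ((a / m) powr p / p + (u / k) powr q / q) + ((b / m) powr p / p + (v / k) powr q / q)"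
    using mk assms by (intro add_mono Youngs_inequality) auto
  also have "\<dots> = 2 * (1 / p + 1 / q)"
    using norm[OF mk(3), of p] norm[OF mk(4), of q] mk(1,2) by (simp add: powr_divide)
  finally have "(a * u + b * v) / (m * k) \<le> 2"
    using assms by (simp add: add_divide_distrib)
  then have "(a * u + b * v) / 2 \<le> m * k"
    using mk by (simp add: field_simps)
  then show ?thesis by (simp add: m_def k_def)
next
  case False
  \<comment> \<open>A function of norm 0 vanishes, and then both sides are 0.\<close>
  have "a = 0 \<and> b = 0 \<or> u = 0 \<and> v = 0"
  proof (rule ccontr)
    assume "\<not> ?thesis"
    then have "0 < a powr p + b powr p" "0 < u powr q + v powr q"
      by (auto intro: add_pos_nonneg add_nonneg_pos)
    with False show False by auto
  qed
  then show ?thesis by auto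
qed

text \<open>Hoelder pairs L^q with its conjugate exponent \<open>r\<close>, which is at most 2
  because \<open>q \<ge> 2\<close>. All of the noise is then spent on the contraction from L^p to
  L^r.\<close>

lemma two_point_ge_2:
  assumes "1 < p" "2 \<le> q" "(p - 1) * (q - 1) = \<sigma>\<^sup>2" "0 \<le> \<sigma>" "\<sigma> < 1" "\<bar>s\<bar> \<le> 1" "\<bar>t\<bar> \<le> 1"
  shows "1 + \<sigma> * s * t \<le> power_mean p s * power_mean q t"
proof -
  define r where "r = q / (q - 1)"
  have r: "1 < r" "r \<le> 2" "1 / r + 1 / q = 1" "r - 1 = 1 / (q - 1)"
    using assms by (auto simp: r_def field_simps)
  have "\<sigma>\<^sup>2 * (r - 1) = p - 1"
    unfolding assms(3)[symmetric] r(4) using assms(2) by simp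
  \<comment> \<open>Bounding \<open>\<sigma>\<^sup>2\<close> by 1 in the same relation yields
    \<open>p \<le> r\<close>, as the contraction requires.\<close>
  moreover have "\<sigma>\<^sup>2 * (r - 1) \<le> 1 * (r - 1)"
    using assms r by (intro mult_right_mono) (auto simp: abs_square_le_1)
  ultimately have pr: "p \<le> r" "\<sigma>\<^sup>2 * (r - 1) = p - 1" by auto
  have ss: "\<bar>\<sigma> * s\<bar> \<le> 1"
    using assms mult_mono[of \<sigma> 1 "\<bar>s\<bar>" 1] by (simp add: abs_mult)
  have "1 + \<sigma> * s * t = ((1 + \<sigma> * s) * (1 + t) + (1 - \<sigma> * s) * (1 - t)) / 2"
    by (simp add: algebra_simps)
  also have "\<dots> \<le> power_mean r (\<sigma> * s) * power_mean q t"
    unfolding power_mean_def even_mean_def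
    by (rule Holder_two_point) (use r assms ss in \<open>auto simp: abs_le_iff\<close>)
  also have "\<dots> \<le> power_mean p s * power_mean q t"
    using pr r assms by (intro mult_right_mono power_mean_contraction) (auto simp: power_mean_def)
  finally show ?thesis .
qed

lemma two_point_normalized:
  assumes "1 < p" "1 < q" "(p - 1) * (q - 1) = \<sigma>\<^sup>2" "0 \<le> \<sigma>" "\<sigma> < 1" "\<bar>s\<bar> \<le> 1" "\<bar>t\<bar> \<le> 1"
  shows "1 + \<sigma> * s * t \<le> power_mean p s * power_mean q t"
proof -
  consider "p \<le> 2" "q \<le> 2" | "2 \<le> q" | "2 \<le> p" by linarith
  then show ?thesis
  proof cases
    case 1
    then show ?thesis using assms by (intro two_point_le_2)
  next
    case 2
    then show ?thesis using assms by (intro two_point_ge_2)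
  next
    case 3
    then have "1 + \<sigma> * t * s \<le> power_mean q t * power_mean p s"
      using assms by (intro two_point_ge_2) (auto simp: mult.commute)
    then show ?thesis by (simp add: mult_ac)
  qed
qed

text \<open>Each equal pair of \<sigma>-correlated uniform bits has probability
  \<open>(1 + \<sigma>) / 4\<close>, each unequal pair \<open>(1 - \<sigma>) / 4\<close>. Both sides
  are homogeneous in \<open>(a, b)\<close> and in \<open>(u, v)\<close>, so functions of mean 1
  suffice once zero functions are set aside.\<close>

lemma two_point_hypercontractive:
  fixes a b u v :: real
  assumes "1 < p" "1 < q" "(p - 1) * (q - 1) = \<sigma>\<^sup>2" "0 \<le> \<sigma>" "\<sigma> < 1"
    and "0 \<le> a" "0 \<le> b" "0 \<le> u" "0 \<le> v"
  shows "(1 + \<sigma>) / 4 * (a * u + b * v) + (1 - \<sigma>) / 4 * (a * v + b * u)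
    \<le> ((a powr p + b powr p) / 2) powr (1 / p) * ((u powr q + v powr q) / 2) powr (1 / q)"
proof (cases "a + b = 0 \<or> u + v = 0")
  case True
  then have "a = 0 \<and> b = 0 \<or> u = 0 \<and> v = 0" using assms by auto
  then show ?thesis by auto
next
  case False
  have norm: "\<exists>m s. m > 0 \<and> \<bar>s\<bar> \<le> 1 \<and> x = m * (1 + s) \<and> y = m * (1 - s) \<and>
      ((x powr r + y powr r) / 2) powr (1 / r) = m * power_mean r s"
    if "0 \<le> x" "0 \<le> y" "x + y \<noteq> 0" "1 < r" for x y r :: real
  proof (intro exI conjI)
    define m s where "m = (x + y) / 2" and "s = (x - y) / (x + y)"
    show m: "m > 0" using that by (simp add: m_def)
    show "\<bar>s\<bar> \<le> 1" using that by (auto simp: s_def divide_le_eq abs_le_iff)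
    show x: "x = m * (1 + s)" and y: "y = m * (1 - s)"
      using that by (auto simp: m_def s_def field_simps)
    have "(x powr r + y powr r) / 2 = m powr r * even_mean r s"
      unfolding even_mean_def x y powr_mult by (simp add: field_simps)
    then show "((x powr r + y powr r) / 2) powr (1 / r) = m * power_mean r s"
      using m that by (simp add: power_mean_def powr_mult powr_powr)
  qed
  obtain m s where m: "m > 0" "\<bar>s\<bar> \<le> 1" "a = m * (1 + s)" "b = m * (1 - s)"
      "((a powr p + b powr p) / 2) powr (1 / p) = m * power_mean p s"
    using norm[of a b p] False assms by auto
  obtain k t where k: "k > 0" "\<bar>t\<bar> \<le> 1" "u = k * (1 + t)" "v = k * (1 - t)"
      "((u powr q + v powr q) / 2) powr (1 / q) = k * power_mean q t"
    using norm[of u v q] False assms by auto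
  have "(1 + \<sigma>) / 4 * (a * u + b * v) + (1 - \<sigma>) / 4 * (a * v + b * u) = m * k * (1 + \<sigma> * s * t)"
    unfolding m(3,4) k(3,4) by (simp add: field_simps)
  also have "\<dots> \<le> m * k * (power_mean p s * power_mean q t)"
    using m k assms by (intro mult_left_mono two_point_normalized) auto
  finally show ?thesis unfolding m(5) k(5) by (simp add: mult_ac)
qed

section \<open>Noise on the hypercube\<close>

abbreviation uniform_point :: "nat \<Rightarrow> bool list pmf" where
  "uniform_point d \<equiv> pmf_of_set (cube d)"

text \<open>For \<open>\<delta> = 1 / (2 * c)\<close> this is the joint law of the point behind the
  query and the query. Coordinates have correlation \<open>1 - 2 * \<delta>\<close>, hence
  \<open>1 - 1 / c\<close>.\<close>

definition noisy_pair :: "real \<Rightarrow> nat \<Rightarrow> (bool list \<times> bool list) pmf" where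
  "noisy_pair \<delta> d =
     do {
       x \<leftarrow> uniform_point d;
       flips \<leftarrow> replicate_pmf d (bernoulli_pmf \<delta>);
       return_pmf (x, map2 (\<noteq>) x flips)
     }"

section \<open>Sampling coordinate by coordinate\<close>

lemma cube_0: "cube 0 = {[]}"
  by (auto simp: cube_def)

lemma cube_Suc: "cube (Suc d) = (\<Union>b\<in>UNIV. (#) b ` cube d)"
  by (auto simp: cube_def length_Suc_conv)

lemma finite_cube [simp]: "finite (cube d)"
  by (induction d) (auto simp: cube_0 cube_Suc)

lemma cube_nonempty [simp]: "cube d \<noteq> {}"
  by (induction d) (auto simp: cube_0 cube_Suc)

lemma card_cube: "card (cube d) = 2 ^ d"
  using card_lists_length_eq[of "UNIV :: bool set" d] by (simp add: cube_def)

lemma uniform_point_0: "uniform_point 0 = return_pmf []"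
  by (simp add: cube_0 pmf_of_set_singleton)

lemma uniform_point_Suc:
  "uniform_point (Suc d) = do {b \<leftarrow> pmf_of_set UNIV; x \<leftarrow> uniform_point d; return_pmf (b # x)}"
proof -
  have "uniform_point (Suc d) = do {b \<leftarrow> pmf_of_set UNIV; pmf_of_set ((#) b ` cube d)}"
    unfolding cube_Suc
    by (rule pmf_of_set_UN[where n = "card (cube d)"]) (auto simp: disjoint_family_on_def card_image)
  also have "\<dots> = do {b \<leftarrow> pmf_of_set UNIV; map_pmf ((#) b) (uniform_point d)}"
    by (intro bind_pmf_cong refl map_pmf_of_set_inj[symmetric]) auto
  finally show ?thesis by (simp add: map_pmf_def)
qed

lemma noisy_pair_0: "noisy_pair \<delta> 0 = return_pmf ([], [])"
  by (simp add: noisy_pair_def uniform_point_0 bind_return_pmf)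

text \<open>Splits off the first coordinate for induction on the dimension. The one nontrivial move
  is to draw the first flip before the rest of the point.\<close>

lemma noisy_pair_Suc:
  "noisy_pair \<delta> (Suc d) =
     do {
       b \<leftarrow> pmf_of_set UNIV;
       e \<leftarrow> bernoulli_pmf \<delta>;
       (x, y) \<leftarrow> noisy_pair \<delta> d;
       return_pmf (b # x, (b \<noteq> e) # y)
     }"
proof -
  have "noisy_pair \<delta> (Suc d) =
     do {
       b \<leftarrow> pmf_of_set UNIV;
       x \<leftarrow> uniform_point d;
       e \<leftarrow> bernoulli_pmf \<delta>;
       flips \<leftarrow> replicate_pmf d (bernoulli_pmf \<delta>);
       return_pmf (b # x, (b \<noteq> e) # map2 (\<noteq>) x flips)
     }"
    by (simp add: noisy_pair_def uniform_point_Suc bind_assoc_pmf bind_return_pmf)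
  also have "\<dots> =
     do {
       b \<leftarrow> pmf_of_set UNIV;
       e \<leftarrow> bernoulli_pmf \<delta>;
       x \<leftarrow> uniform_point d;
       flips \<leftarrow> replicate_pmf d (bernoulli_pmf \<delta>);
       return_pmf (b # x, (b \<noteq> e) # map2 (\<noteq>) x flips)
     }"
    by (intro bind_pmf_cong refl, subst bind_commute_pmf) (rule refl)
  finally show ?thesis
    by (simp add: noisy_pair_def bind_assoc_pmf bind_return_pmf)
qed

lemma set_noisy_pair: "set_pmf (noisy_pair \<delta> d) \<subseteq> cube d \<times> cube d"
  by (auto simp: noisy_pair_def set_replicate_pmf) (auto simp: cube_def)

lemma finite_set_noisy_pair [simp]: "finite (set_pmf (noisy_pair \<delta> d))"
  by (rule finite_subset[OF set_noisy_pair]) simp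

text \<open>Flipping a uniform bit by an independent one leaves it uniform.\<close>

lemma map_snd_noisy_pair: "map_pmf snd (noisy_pair \<delta> d) = uniform_point d"
proof (induction d)
  case 0
  show ?case by (simp add: noisy_pair_0 uniform_point_0)
next
  case (Suc d)
  have flip: "map_pmf (\<lambda>b. b \<noteq> e) (pmf_of_set UNIV) = pmf_of_set UNIV" for e :: bool
    by (rule map_pmf_of_set_bij_betw) (cases e; auto simp: bij_betw_def inj_on_def UNIV_bool image_iff)+
  have "map_pmf snd (noisy_pair \<delta> (Suc d)) =
     do {b \<leftarrow> pmf_of_set UNIV; e \<leftarrow> bernoulli_pmf \<delta>; y \<leftarrow> map_pmf snd (noisy_pair \<delta> d);
         return_pmf ((b \<noteq> e) # y)}"
    by (simp add: noisy_pair_Suc map_bind_pmf bind_map_pmf case_prod_unfold)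
  also have "\<dots> = do {e \<leftarrow> bernoulli_pmf \<delta>; b \<leftarrow> map_pmf (\<lambda>b. b \<noteq> e) (pmf_of_set UNIV);
      y \<leftarrow> uniform_point d; return_pmf (b # y)}"
    unfolding Suc.IH by (subst bind_commute_pmf) (simp add: bind_map_pmf)
  also have "\<dots> = uniform_point (Suc d)"
    unfolding flip by (simp add: uniform_point_Suc)
  finally show ?case .
qed

lemma expectation_uniform_point_Suc:
  fixes f :: "bool list \<Rightarrow> real"
  shows "measure_pmf.expectation (uniform_point (Suc d)) f =
    (measure_pmf.expectation (uniform_point d) (\<lambda>x. f (True # x)) +
     measure_pmf.expectation (uniform_point d) (\<lambda>x. f (False # x))) / 2"
  by (simp add: uniform_point_Suc map_pmf_def[symmetric] UNIV_bool
      pmf_expectation_bind[where A = UNIV] add_divide_distrib)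

lemma expectation_noisy_pair_Suc:
  fixes f :: "bool list \<Rightarrow> bool list \<Rightarrow> real" and \<delta> :: real and d :: nat
  assumes "0 \<le> \<delta>" "\<delta> \<le> 1"
  defines "E \<equiv> \<lambda>b b'. measure_pmf.expectation (noisy_pair \<delta> d) (\<lambda>(x, y). f (b # x) (b' # y))"
  shows "measure_pmf.expectation (noisy_pair \<delta> (Suc d)) (\<lambda>(x, y). f x y) =
    (1 - \<delta>) / 2 * (E True True + E False False) + \<delta> / 2 * (E True False + E False True)"
proof -
  define N where "N b e = map_pmf (\<lambda>(x, y). (b # x, (b \<noteq> e) # y)) (noisy_pair \<delta> d)" for b e
  have conv: "noisy_pair \<delta> (Suc d) = do {b \<leftarrow> pmf_of_set UNIV; e \<leftarrow> bernoulli_pmf \<delta>; N b e}"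
    by (simp add: noisy_pair_Suc N_def map_pmf_def case_prod_unfold)
  have N: "measure_pmf.expectation (N b e) (\<lambda>(x, y). f x y) = E b (b \<noteq> e)" for b e
    by (simp add: N_def E_def case_prod_unfold)
  have fin: "finite (set_pmf (N b e))" for b e
    by (simp add: N_def)
  have step: "measure_pmf.expectation (bernoulli_pmf \<delta> \<bind> N b) (\<lambda>(x, y). f x y) =
      \<delta> * E b (\<not> b) + (1 - \<delta>) * E b b" for b
    using assms(1,2) by (subst pmf_expectation_bind[where A = UNIV]) (auto simp: fin N UNIV_bool)
  show ?thesis
    unfolding conv
    by (subst pmf_expectation_bind[where A = UNIV]) (simp_all add: fin UNIV_bool step, simp add: field_simps)
qed

text \<open>The data points are i.i.d., so \<open>j\<close> may be drawn first and its point
  inserted among \<open>n - 1\<close> others drawn separately. This exhibits those others as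
  independent of the pair formed by the point and its query.\<close>

lemma random_instance_conv:
  assumes "n > 0"
  shows "random_instance c n d =
     do {
       j \<leftarrow> pmf_of_set {..<n};
       ys \<leftarrow> replicate_pmf (n - 1) (uniform_point d);
       (x, q) \<leftarrow> noisy_pair (1 / (2 * c)) d;
       return_pmf (take j ys @ x # drop j ys, j, q)
     }"
proof -
  define U where "U = uniform_point d"
  define R where "R = replicate_pmf d (bernoulli_pmf (1 / (2 * c)))"
  have split: "replicate_pmf n U =
     do {ys \<leftarrow> replicate_pmf (n - 1) U; x \<leftarrow> U; return_pmf (take j ys @ x # drop j ys)}"
    if "j < n" for j
  proof -
    define k where "k = n - 1 - j"
    have n: "n = j + Suc k" "n - 1 = j + k" using that by (auto simp: k_def)
    have "do {ys \<leftarrow> replicate_pmf (n - 1) U; x \<leftarrow> U; return_pmf (take j ys @ x # drop j ys)} =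
       do {ys \<leftarrow> replicate_pmf j U; zs \<leftarrow> replicate_pmf k U; x \<leftarrow> U;
           return_pmf (take j (ys @ zs) @ x # drop j (ys @ zs))}"
      unfolding n(2) replicate_pmf_distrib by (simp add: bind_assoc_pmf bind_return_pmf)
    also have "\<dots> = do {ys \<leftarrow> replicate_pmf j U; zs \<leftarrow> replicate_pmf k U; x \<leftarrow> U;
           return_pmf (ys @ x # zs)}"
      by (intro bind_pmf_cong refl) (auto simp: set_replicate_pmf)
    also have "\<dots> = do {ys \<leftarrow> replicate_pmf j U; x \<leftarrow> U; zs \<leftarrow> replicate_pmf k U;
           return_pmf (ys @ x # zs)}"
      by (intro bind_pmf_cong refl, subst bind_commute_pmf) (rule refl)
    also have "\<dots> = replicate_pmf n U"
      unfolding n(1) replicate_pmf_distrib by (simp add: bind_assoc_pmf bind_return_pmf)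
    finally show ?thesis ..
  qed
  have "random_instance c n d =
     do {j \<leftarrow> pmf_of_set {..<n}; ps \<leftarrow> replicate_pmf n U; flips \<leftarrow> R;
         return_pmf (ps, j, map2 (\<noteq>) (ps ! j) flips)}"
    unfolding random_instance_def U_def R_def by (subst bind_commute_pmf) (rule refl)
  also have "\<dots> = do {j \<leftarrow> pmf_of_set {..<n}; ys \<leftarrow> replicate_pmf (n - 1) U; x \<leftarrow> U; flips \<leftarrow> R;
         return_pmf (take j ys @ x # drop j ys, j, map2 (\<noteq>) x flips)}"
  proof (rule bind_pmf_cong[OF refl])
    fix j assume "j \<in> set_pmf (pmf_of_set {..<n})"
    then have j: "j < n" using assms by (subst (asm) set_pmf_of_set) auto
    have nth: "(take j ys @ x # drop j ys) ! j = x" if "length ys = n - 1" for ys and x :: "bool list"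
      using that j by (simp add: nth_append)
    show "do {ps \<leftarrow> replicate_pmf n U; flips \<leftarrow> R; return_pmf (ps, j, map2 (\<noteq>) (ps ! j) flips)} =
        do {ys \<leftarrow> replicate_pmf (n - 1) U; x \<leftarrow> U; flips \<leftarrow> R;
         return_pmf (take j ys @ x # drop j ys, j, map2 (\<noteq>) x flips)}"
      unfolding split[OF j] bind_assoc_pmf bind_return_pmf
      by (intro bind_pmf_cong refl) (auto simp: set_replicate_pmf nth)
  qed
  finally show ?thesis
    by (simp add: noisy_pair_def bind_assoc_pmf bind_return_pmf U_def R_def)
qed

section \<open>Hypercontractivity on the cube\<close>

text \<open>Tensorization: given the first bits, the induction hypothesis bounds the conditional
  expectation by a product \<open>F b * G b'\<close> of norms of restrictions, and the two-point
  inequality applies to \<open>F\<close> and \<open>G\<close> as functions of those bits.\<close>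

lemma hypercontractive:
  fixes f g :: "bool list \<Rightarrow> real"
  assumes "1 < p" "1 < q" "(p - 1) * (q - 1) = (1 - 2 * \<delta>)\<^sup>2" "0 < \<delta>" "\<delta> \<le> 1 / 2"
    and "\<And>x. 0 \<le> f x" "\<And>y. 0 \<le> g y"
  shows "measure_pmf.expectation (noisy_pair \<delta> d) (\<lambda>(x, y). f x * g y)
    \<le> measure_pmf.expectation (uniform_point d) (\<lambda>x. f x powr p) powr (1 / p) *
      measure_pmf.expectation (uniform_point d) (\<lambda>y. g y powr q) powr (1 / q)"
  using assms(6,7)
proof (induction d arbitrary: f g)
  case 0
  then show ?case using assms(1,2) by (simp add: noisy_pair_0 uniform_point_0 powr_powr)
next
  case (Suc d)
  define F where "F b = measure_pmf.expectation (uniform_point d) (\<lambda>x. f (b # x) powr p) powr (1 / p)" for b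
  define G where "G b = measure_pmf.expectation (uniform_point d) (\<lambda>y. g (b # y) powr q) powr (1 / q)" for b
  define E where "E b b' = measure_pmf.expectation (noisy_pair \<delta> d) (\<lambda>(x, y). f (b # x) * g (b' # y))" for b b'
  have E: "E b b' \<le> F b * G b'" for b b'
    unfolding E_def F_def G_def by (rule Suc.IH) (use Suc.prems in auto)
  \<comment> \<open>Averaged over the first bit, these powers give back the moments of
    \<open>f\<close> and \<open>g\<close> in dimension \<open>Suc d\<close>.\<close>
  have FG: "F b powr p = measure_pmf.expectation (uniform_point d) (\<lambda>x. f (b # x) powr p)"
    "G b powr q = measure_pmf.expectation (uniform_point d) (\<lambda>y. g (b # y) powr q)" for b
    using assms(1,2) by (simp_all add: F_def G_def powr_powr integral_nonneg_AE)
  have "measure_pmf.expectation (noisy_pair \<delta> (Suc d)) (\<lambda>(x, y). f x * g y) =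
      (1 - \<delta>) / 2 * (E True True + E False False) + \<delta> / 2 * (E True False + E False True)"
    unfolding E_def by (rule expectation_noisy_pair_Suc) (use assms in auto)
  also have "\<dots> \<le> (1 - \<delta>) / 2 * (F True * G True + F False * G False) + \<delta> / 2 * (F True * G False + F False * G True)"
    using assms by (intro add_mono mult_left_mono E) auto
  \<comment> \<open>The same weights in terms of the correlation
    \<open>1 - 2 * \<delta>\<close>.\<close>
  also have "\<dots> = (1 + (1 - 2 * \<delta>)) / 4 * (F True * G True + F False * G False) +
      (1 - (1 - 2 * \<delta>)) / 4 * (F True * G False + F False * G True)"
    by (simp add: field_simps)
  also have "\<dots> \<le> ((F True powr p + F False powr p) / 2) powr (1 / p) *
      ((G True powr q + G False powr q) / 2) powr (1 / q)"
    using assms by (intro two_point_hypercontractive) (auto simp: F_def G_def)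
  finally show ?case
    unfolding FG expectation_uniform_point_Suc .
qed

text \<open>Indicators are unchanged by powers, so their norms are powers of the densities.\<close>

lemma noisy_pair_small_sets:
  assumes "1 < p" "1 < q" "(p - 1) * (q - 1) = (1 - 2 * \<delta>)\<^sup>2" "0 < \<delta>" "\<delta> \<le> 1 / 2"
  shows "measure_pmf.prob (noisy_pair \<delta> d) (A \<times> B)
    \<le> measure_pmf.prob (uniform_point d) A powr (1 / p) * measure_pmf.prob (uniform_point d) B powr (1 / q)"
proof -
  have pow: "(\<lambda>x. indicat_real C x powr r) = indicat_real C" for C :: "bool list set" and r
    by (auto simp: indicator_def)
  have "(\<lambda>(x, y). indicat_real A x * indicat_real B y) = indicat_real (A \<times> B)"
    by (auto simp: indicator_def)
  then show ?thesis
    using hypercontractive[OF assms, of "indicat_real A" "indicat_real B" d] by (simp add: pow)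
qed

section \<open>Sampled points that fall in a set\<close>

lemma emeasure_replicate_pmf_avoid:
  "emeasure (replicate_pmf n p) {ys. z \<notin> set ys} = ennreal ((1 - pmf p z) ^ n)"
proof (induction n)
  case (Suc n)
  have "emeasure (measure_pmf (replicate_pmf n p \<bind> (\<lambda>ys. return_pmf (x # ys)))) {ys. z \<notin> set ys} =
      indicator (- {z}) x * ennreal ((1 - pmf p z) ^ n)" for x
    unfolding map_pmf_def[symmetric] emeasure_map_pmf
    using Suc.IH by (auto simp: vimage_def indicator_def)
  then have "emeasure (replicate_pmf (Suc n) p) {ys. z \<notin> set ys} =
      (\<integral>\<^sup>+x. indicator (- {z}) x * ennreal ((1 - pmf p z) ^ n) \<partial>p)"
    by simp
  also have "\<dots> = emeasure p (- {z}) * ennreal ((1 - pmf p z) ^ n)"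
    by (simp add: nn_integral_multc)
  also have "emeasure p (- {z}) = ennreal (1 - pmf p z)"
    using measure_pmf.prob_compl[of "{z}" p]
    by (simp add: measure_pmf.emeasure_eq_measure Compl_eq_Diff_UNIV measure_pmf_single)
  finally show ?case
    by (simp add: ennreal_mult[symmetric] pmf_le_1)
qed simp

text \<open>A reverse Bernoulli bound. Since \<open>(1 - x) ^ n * (1 + n * x) \<le> 1\<close>, it is
  enough that \<open>(1 - n * x / 2) * (1 + n * x) \<ge> 1\<close>, which is where
  \<open>n * x \<le> 1\<close> enters.\<close>

lemma one_minus_power_le:
  fixes x :: real
  assumes "0 \<le> x" "x \<le> 1" "real n * x \<le> 1"
  shows "(1 - x) ^ n \<le> 1 - n * x / 2"
proof -
  have "(1 - x) ^ n * (1 + n * x) \<le> (1 - x) ^ n * (1 + x) ^ n"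
    using assms by (intro mult_left_mono Bernoulli_inequality) auto
  also have "\<dots> = (1 - x\<^sup>2) ^ n"
    by (simp add: power_mult_distrib[symmetric] algebra_simps power2_eq_square)
  also have "\<dots> \<le> 1"
    using assms by (intro power_le_one) (auto simp: power_le_one)
  also have "\<dots> \<le> (1 - n * x / 2) * (1 + n * x)"
  proof -
    have "0 \<le> n * x * (1 - n * x)" using assms by (intro mult_nonneg_nonneg) auto
    then show ?thesis by (simp add: algebra_simps)
  qed
  finally have "(1 - x) ^ n * (1 + n * x) \<le> (1 - n * x / 2) * (1 + n * x)" .
  moreover have "0 < 1 + n * x" using assms by (intro add_pos_nonneg) auto
  ultimately show ?thesis by (simp add: mult_le_cancel_right)
qed

text \<open>The factor \<open>1/2\<close> accounts for repeated sample points, which are stored only once.\<close>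

lemma expected_card_samples_ge:
  assumes "n \<le> 2 ^ d" "A \<subseteq> cube d"
  shows "ennreal (real n * measure_pmf.prob (uniform_point d) A / 2)
    \<le> (\<integral>\<^sup>+ ys. of_nat (card (set ys \<inter> A)) \<partial>replicate_pmf n (uniform_point d))"
proof -
  define R where "R = replicate_pmf n (uniform_point d)"
  define x :: real where "x = 1 / 2 ^ d"
  have finA: "finite A" using assms finite_cube finite_subset by blast
  \<comment> \<open>Counting distinct sample points as a sum over \<open>A\<close> reduces the
    expectation to the chance that one given point is sampled.\<close>
  have card: "of_nat (card (set ys \<inter> A)) = (\<Sum>z\<in>A. indicator {ys. z \<in> set ys} ys :: ennreal)" for ys
  proof -
    have "(\<Sum>z\<in>A. indicator {ys. z \<in> set ys} ys :: ennreal) = (\<Sum>z\<in>A \<inter> set ys. 1)"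
      using finA by (intro sum.mono_neutral_cong_right) (auto simp: indicator_def)
    then show ?thesis by (simp add: Int_commute)
  qed
  have hit: "ennreal (real n * x / 2) \<le> emeasure R {ys. z \<in> set ys}" if "z \<in> A" for z
  proof -
    \<comment> \<open>\<open>n \<le> 2 ^ d\<close> becomes \<open>n * x \<le> 1\<close>: a given
      point is drawn at most once on average.\<close>
    have x: "0 \<le> x" "x \<le> 1" "real n * x \<le> 1"
      using assms(1) by (auto simp: x_def divide_le_eq simp flip: of_nat_le_iff)
    have z: "z \<in> cube d" using that assms by auto
    have "pmf (uniform_point d) z = x"
      using z by (simp add: x_def card_cube)
    then have "emeasure R {ys. z \<notin> set ys} = ennreal ((1 - x) ^ n)"
      unfolding R_def emeasure_replicate_pmf_avoid by simp
    then have "measure R {ys. z \<notin> set ys} = (1 - x) ^ n"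
      using x by (simp add: measure_def)
    moreover have "measure R {ys. z \<in> set ys} = 1 - measure R {ys. z \<notin> set ys}"
      using measure_pmf.prob_compl[of "{ys. z \<notin> set ys}" R] by (simp add: set_diff_eq)
    ultimately have "real n * x / 2 \<le> measure R {ys. z \<in> set ys}"
      using one_minus_power_le[OF x] by simp
    then show ?thesis by (simp add: measure_pmf.emeasure_eq_measure ennreal_leI)
  qed
  have "ennreal (real n * measure_pmf.prob (uniform_point d) A / 2) = ennreal (\<Sum>z\<in>A. real n * x / 2)"
    using assms(2) by (simp add: measure_pmf_of_set x_def card_cube Int_absorb1 mult_ac)
  also have "\<dots> = (\<Sum>z\<in>A. ennreal (real n * x / 2))"
    by (intro sum_ennreal[symmetric]) (simp add: x_def)
  also have "\<dots> \<le> (\<Sum>z\<in>A. emeasure R {ys. z \<in> set ys})"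
    by (intro sum_mono hit)
  also have "\<dots> = (\<integral>\<^sup>+ ys. of_nat (card (set ys \<inter> A)) \<partial>R)"
    unfolding card by (simp add: nn_integral_sum)
  finally show ?thesis by (simp add: R_def)
qed

lemma nn_integral_random_instance_pair:
  assumes "n > 0"
  shows "(\<integral>\<^sup>+ (ps, j, q). h (ps ! j) q \<partial>random_instance c n d) =
    (\<integral>\<^sup>+ (x, q). h x q \<partial>noisy_pair (1 / (2 * c)) d)"
proof -
  have "(\<integral>\<^sup>+ (ps, j, q). h (ps ! j) q \<partial>random_instance c n d) =
    (\<integral>\<^sup>+ j. \<integral>\<^sup>+ ys. \<integral>\<^sup>+ (x, q). h ((take j ys @ x # drop j ys) ! j) q
      \<partial>noisy_pair (1 / (2 * c)) d \<partial>replicate_pmf (n - 1) (uniform_point d) \<partial>pmf_of_set {..<n})"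
    unfolding random_instance_conv[OF assms] by (simp add: case_prod_unfold)
  also have "\<dots> = (\<integral>\<^sup>+ j. \<integral>\<^sup>+ ys. \<integral>\<^sup>+ (x, q). h x q
      \<partial>noisy_pair (1 / (2 * c)) d \<partial>replicate_pmf (n - 1) (uniform_point d) \<partial>pmf_of_set {..<n})"
  proof (rule nn_integral_cong_AE, rule AE_pmfI, rule nn_integral_cong_AE, rule AE_pmfI)
    fix j ys assume "j \<in> set_pmf (pmf_of_set {..<n})" "ys \<in> set_pmf (replicate_pmf (n - 1) (uniform_point d))"
    moreover have "set_pmf (pmf_of_set {..<n}) = {..<n}" using assms by (intro set_pmf_of_set) auto
    ultimately have "j \<le> length ys" using assms by (auto simp: set_replicate_pmf)
    then show "(\<integral>\<^sup>+ (x, q). h ((take j ys @ x # drop j ys) ! j) q \<partial>noisy_pair (1 / (2 * c)) d) =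
        (\<integral>\<^sup>+ (x, q). h x q \<partial>noisy_pair (1 / (2 * c)) d)"
      by (simp add: nth_append)
  qed
  finally show ?thesis by simp
qed

lemma nn_integral_noisy_pair_snd:
  "(\<integral>\<^sup>+ (x, q). h q \<partial>noisy_pair \<delta> d) = (\<integral>\<^sup>+ q. h q \<partial>uniform_point d)"
  by (simp add: map_snd_noisy_pair[of \<delta> d, symmetric] case_prod_unfold)

lemma nn_integral_random_instance_query:
  assumes "n > 0"
  shows "(\<integral>\<^sup>+ (ps, j, q). h q \<partial>random_instance c n d) = (\<integral>\<^sup>+ q. h q \<partial>uniform_point d)"
  using nn_integral_random_instance_pair[OF assms, where h = "\<lambda>_. h"] nn_integral_noisy_pair_snd by simp

text \<open>The points other than the one behind the query are independent of the query.\<close>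

lemma expected_card_random_instance_ge:
  assumes "2 \<le> n" "n \<le> 2 ^ d" "A \<subseteq> cube d"
  shows "(\<integral>\<^sup>+ q. h q \<partial>uniform_point d) * ennreal (real n * measure_pmf.prob (uniform_point d) A / 4)
    \<le> (\<integral>\<^sup>+ (ps, j, q). h q * of_nat (card (set ps \<inter> A)) \<partial>random_instance c n d)"
proof -
  define H where "H = (\<integral>\<^sup>+ q. h q \<partial>uniform_point d)"
  have H: "(\<integral>\<^sup>+ (x, q). h q * k \<partial>noisy_pair (1 / (2 * c)) d) = H * k" for k
    unfolding H_def nn_integral_noisy_pair_snd[where \<delta> = "1 / (2 * c)", symmetric] case_prod_unfold
    by (rule nn_integral_multc) simp
  \<comment> \<open>For \<open>n \<ge> 2\<close> this turns the 1/2 in the sampling bound for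
    \<open>n - 1\<close> points into 1/4.\<close>
  have "real n / 4 \<le> real (n - 1) / 2" using assms by (auto simp: of_nat_diff)
  then have "real n * measure_pmf.prob (uniform_point d) A / 4 \<le> real (n - 1) * measure_pmf.prob (uniform_point d) A / 2"
    using mult_right_mono[of "real n / 4" "real (n - 1) / 2" "measure_pmf.prob (uniform_point d) A"] by simp
  then have "ennreal (real n * measure_pmf.prob (uniform_point d) A / 4)
      \<le> ennreal (real (n - 1) * measure_pmf.prob (uniform_point d) A / 2)"
    by (rule ennreal_leI)
  also have "\<dots> \<le> (\<integral>\<^sup>+ ys. of_nat (card (set ys \<inter> A)) \<partial>replicate_pmf (n - 1) (uniform_point d))"
    using assms by (intro expected_card_samples_ge) auto
  finally have "H * ennreal (real n * measure_pmf.prob (uniform_point d) A / 4)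
      \<le> H * (\<integral>\<^sup>+ ys. of_nat (card (set ys \<inter> A)) \<partial>replicate_pmf (n - 1) (uniform_point d))"
    by (rule mult_left_mono) simp
  also have "\<dots> = (\<integral>\<^sup>+ j. \<integral>\<^sup>+ ys. H * of_nat (card (set ys \<inter> A))
      \<partial>replicate_pmf (n - 1) (uniform_point d) \<partial>pmf_of_set {..<n})"
    by (simp add: nn_integral_cmult)
  also have "\<dots> = (\<integral>\<^sup>+ j. \<integral>\<^sup>+ ys. \<integral>\<^sup>+ (x, q). h q * of_nat (card (set ys \<inter> A))
      \<partial>noisy_pair (1 / (2 * c)) d \<partial>replicate_pmf (n - 1) (uniform_point d) \<partial>pmf_of_set {..<n})"
    by (simp add: H)
  \<comment> \<open>Putting \<open>x\<close> back into the data set can only add to the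
    count.\<close>
  also have "\<dots> \<le> (\<integral>\<^sup>+ j. \<integral>\<^sup>+ ys. \<integral>\<^sup>+ (x, q). h q * of_nat (card (set (take j ys @ x # drop j ys) \<inter> A))
      \<partial>noisy_pair (1 / (2 * c)) d \<partial>replicate_pmf (n - 1) (uniform_point d) \<partial>pmf_of_set {..<n})"
  proof (intro nn_integral_mono, clarsimp)
    fix j q and x :: "bool list" and ys :: "bool list list"
    have "set ys = set (take j ys) \<union> set (drop j ys)"
      by (metis append_take_drop_id set_append)
    then have "card (set ys \<inter> A) \<le> card (insert x (set (take j ys) \<union> set (drop j ys)) \<inter> A)"
      by (intro card_mono) auto
    then show "h q * of_nat (card (set ys \<inter> A))
        \<le> h q * of_nat (card (insert x (set (take j ys) \<union> set (drop j ys)) \<inter> A))"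
      by (intro mult_left_mono) auto
  qed
  also have "\<dots> = (\<integral>\<^sup>+ (ps, j, q). h q * of_nat (card (set ps \<inter> A)) \<partial>random_instance c n d)"
    using assms by (subst random_instance_conv) (auto simp: case_prod_unfold)
  finally show ?thesis by (simp add: H_def)
qed

section \<open>Cost and success of a fixed structure\<close>

definition region_density :: "nat \<Rightarrow> list_of_points \<Rightarrow> nat \<Rightarrow> real" where
  "region_density d D i = measure_pmf.prob (uniform_point d) (regions D ! i)"

definition probe_density :: "nat \<Rightarrow> list_of_points \<Rightarrow> nat \<Rightarrow> real" where
  "probe_density d D i = measure_pmf.prob (uniform_point d) {q. i \<in> probes D q}"

lemma region_density_nonneg [simp]: "0 \<le> region_density d D i"
  by (simp add: region_density_def)

lemma probe_density_nonneg [simp]: "0 \<le> probe_density d D i"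
  by (simp add: probe_density_def)

lemma set_random_instance_query:
  assumes "n > 0" "(ps, j, q) \<in> set_pmf (random_instance c n d)"
  shows "q \<in> cube d"
  using assms set_noisy_pair[of "1 / (2 * c)" d] by (auto simp: random_instance_conv)

text \<open>The cost of one list, charged when the query lies in \<open>B\<close>: the 1 accounts
  for its index, the rest for its length. \<open>B = UNIV\<close> serves the space bound, the set of
  queries that scan the list serves the time bound.\<close>

lemma expected_list_cost_ge:
  assumes "2 \<le> n" "n \<le> 2 ^ d" "A \<subseteq> cube d"
  shows "ennreal (measure_pmf.prob (uniform_point d) B * (1 + real n * measure_pmf.prob (uniform_point d) A) / 4)
    \<le> (\<integral>\<^sup>+ (ps, j, q). indicator B q * (1 + of_nat (card (set ps \<inter> A))) \<partial>random_instance c n d)"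
proof -
  define a where "a = measure_pmf.prob (uniform_point d) A"
  define b where "b = measure_pmf.prob (uniform_point d) B"
  have ab: "0 \<le> a" "0 \<le> b" by (auto simp: a_def b_def)
  have B: "(\<integral>\<^sup>+ q. indicator B q \<partial>uniform_point d) = ennreal b"
    by (simp add: b_def measure_pmf.emeasure_eq_measure)
  have "ennreal (b * (1 + real n * a) / 4) \<le> ennreal (b + b * (real n * a / 4))"
    using ab by (intro ennreal_leI) (simp add: field_simps)
  also have "\<dots> = ennreal b + ennreal b * ennreal (real n * a / 4)"
    using ab by (simp add: ennreal_mult[symmetric] del: ennreal_plus flip: ennreal_plus)
  also have "\<dots> \<le> (\<integral>\<^sup>+ (ps, j, q). indicator B q \<partial>random_instance c n d) +
      (\<integral>\<^sup>+ (ps, j, q). indicator B q * of_nat (card (set ps \<inter> A)) \<partial>random_instance c n d)"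
    using expected_card_random_instance_ge[OF assms, of "indicator B" c] assms
    by (subst nn_integral_random_instance_query) (auto simp: B a_def intro: add_left_mono)
  also have "\<dots> = (\<integral>\<^sup>+ (ps, j, q). indicator B q * (1 + of_nat (card (set ps \<inter> A))) \<partial>random_instance c n d)"
    by (subst nn_integral_add[symmetric]) (auto simp: case_prod_unfold distrib_left)
  finally show ?thesis by (simp add: a_def b_def)
qed

lemma expected_total_space_ge:
  assumes "2 \<le> n" "n \<le> 2 ^ d" "D \<in> structures d"
  shows "ennreal (\<Sum>i<length (regions D). (1 + real n * region_density d D i) / 4)
    \<le> (\<integral>\<^sup>+ (ps, j, q). of_nat (total_space D (set ps)) \<partial>random_instance c n d)"
proof -
  have "ennreal (\<Sum>i<length (regions D). (1 + real n * region_density d D i) / 4) =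
      (\<Sum>i<length (regions D). ennreal ((1 + real n * region_density d D i) / 4))"
    by (intro sum_ennreal[symmetric]) simp
  also have "\<dots> \<le> (\<Sum>i<length (regions D).
      \<integral>\<^sup>+ (ps, j, q). 1 + of_nat (card (set ps \<inter> regions D ! i)) \<partial>random_instance c n d)"
  proof (intro sum_mono)
    fix i assume "i \<in> {..<length (regions D)}"
    then have "regions D ! i \<subseteq> cube d" using assms by (auto simp: structures_def)
    from expected_list_cost_ge[OF assms(1,2) this, of UNIV c]
    show "ennreal ((1 + real n * region_density d D i) / 4) \<le>
        (\<integral>\<^sup>+ (ps, j, q). 1 + of_nat (card (set ps \<inter> regions D ! i)) \<partial>random_instance c n d)"
      by (simp add: region_density_def)
  qed
  also have "\<dots> = (\<integral>\<^sup>+ (ps, j, q). of_nat (total_space D (set ps)) \<partial>random_instance c n d)"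
    by (subst nn_integral_sum[symmetric])
      (auto simp: total_space_def stored_def case_prod_unfold sum.distrib)
  finally show ?thesis .
qed

lemma expected_query_cost_ge:
  assumes "2 \<le> n" "n \<le> 2 ^ d" "D \<in> structures d"
  shows "ennreal (\<Sum>i<length (regions D). probe_density d D i * (1 + real n * region_density d D i) / 4)
    \<le> (\<integral>\<^sup>+ (ps, j, q). of_nat (query_time D (set ps) q) \<partial>random_instance c n d)"
proof -
  define m where "m = length (regions D)"
  have "ennreal (\<Sum>i<m. probe_density d D i * (1 + real n * region_density d D i) / 4) =
      (\<Sum>i<m. ennreal (probe_density d D i * (1 + real n * region_density d D i) / 4))"
    by (intro sum_ennreal[symmetric]) simp
  also have "\<dots> \<le> (\<Sum>i<m. \<integral>\<^sup>+ (ps, j, q).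
      indicator {q. i \<in> probes D q} q * (1 + of_nat (card (set ps \<inter> regions D ! i))) \<partial>random_instance c n d)"
  proof (intro sum_mono)
    fix i assume "i \<in> {..<m}"
    then have "regions D ! i \<subseteq> cube d" using assms by (auto simp: structures_def m_def)
    from expected_list_cost_ge[OF assms(1,2) this, of "{q. i \<in> probes D q}" c]
    show "ennreal (probe_density d D i * (1 + real n * region_density d D i) / 4) \<le> (\<integral>\<^sup>+ (ps, j, q).
      indicator {q. i \<in> probes D q} q * (1 + of_nat (card (set ps \<inter> regions D ! i))) \<partial>random_instance c n d)"
      by (simp add: region_density_def probe_density_def)
  qed
  also have "\<dots> = (\<integral>\<^sup>+ (ps, j, q). (\<Sum>i<m.
      indicator {q. i \<in> probes D q} q * (1 + of_nat (card (set ps \<inter> regions D ! i)))) \<partial>random_instance c n d)"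
    by (subst nn_integral_sum[symmetric]) (auto simp: case_prod_unfold)
  also have "\<dots> = (\<integral>\<^sup>+ (ps, j, q). of_nat (query_time D (set ps) q) \<partial>random_instance c n d)"
  proof (rule nn_integral_cong_AE, rule AE_pmfI, clarify)
    fix ps j q assume "(ps, j, q) \<in> set_pmf (random_instance c n d)"
    \<comment> \<open>\<open>structures\<close> constrains the probes on the cube, so the sum over
      all lists is matched with the query time on the support of the instance.\<close>
    then have "q \<in> cube d" using assms by (intro set_random_instance_query) auto
    then have sub: "probes D q \<subseteq> {..<m}" using assms by (auto simp: structures_def m_def)
    have "(\<Sum>i<m. indicator {q. i \<in> probes D q} q * (1 + of_nat (card (set ps \<inter> regions D ! i))) :: ennreal) =
        (\<Sum>i\<in>probes D q. 1 + of_nat (card (set ps \<inter> regions D ! i)))"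
      using sub by (intro sum.mono_neutral_cong_right) (auto simp: indicator_def)
    also have "\<dots> = of_nat (query_time D (set ps) q)"
      by (simp add: query_time_def stored_def sum.distrib)
    finally show "(\<Sum>i<m. indicator {q. i \<in> probes D q} q * (1 + of_nat (card (set ps \<inter> regions D ! i))) :: ennreal) =
        of_nat (query_time D (set ps) q)" .
  qed
  finally show ?thesis by (simp add: m_def)
qed

text \<open>If all other points are farther than \<open>R\<close> from the query, a success must
  find the point behind the query, so that point lies in a region whose list is scanned. A union
  bound over the lists and the small-set bound for each finish the estimate.\<close>

lemma success_prob_structure_le:
  fixes p q c R :: real and n d :: nat
  assumes "1 < p" "1 < q" "(p - 1) * (q - 1) = (1 - 1 / c)\<^sup>2" "1 < c" "n > 0" "D \<in> structures d"
  defines "G \<equiv> {(ps, j, q). \<forall>k<n. k \<noteq> j \<longrightarrow> l1_dist (ps ! k) q > R}"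
  shows "measure_pmf.prob (random_instance c n d) {(ps, j, q). succeeds R D (set ps) q}
    \<le> (1 - measure_pmf.prob (random_instance c n d) G) +
      (\<Sum>i<length (regions D). region_density d D i powr (1 / p) * probe_density d D i powr (1 / q))"
proof -
  define RI where "RI = random_instance c n d"
  define NP where "NP = noisy_pair (1 / (2 * c)) d"
  define m where "m = length (regions D)"
  \<comment> \<open>The pairs of a point and a query that some list brings together.\<close>
  define C where "C = (\<Union>i<m. (regions D ! i) \<times> {q. i \<in> probes D q})"
  define H where "H = {(ps, j, q). (ps ! j, q) \<in> C}"
  have "measure_pmf.prob RI {(ps, j, q). succeeds R D (set ps) q} \<le> measure_pmf.prob RI (- G \<union> H)"
  proof (rule measure_pmf.finite_measure_mono_AE, rule AE_pmfI, clarify)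
    fix ps j q
    assume supp: "(ps, j, q) \<in> set_pmf RI" and succ: "succeeds R D (set ps) q"
      and "(ps, j, q) \<notin> H" 
    have q: "q \<in> cube d"
      using supp assms by (auto intro: set_random_instance_query simp: RI_def)
    have len: "length ps = n"
      using supp by (auto simp: RI_def random_instance_def set_replicate_pmf)
    obtain i k where ik: "i \<in> probes D q" "k < n" "ps ! k \<in> regions D ! i" "l1_dist (ps ! k) q \<le> R"
      using succ len by (auto simp: succeeds_def stored_def in_set_conv_nth)
    have "i < m" using ik q assms by (auto simp: structures_def m_def)
    \<comment> \<open>Had the scan found index \<open>j\<close>, the pair \<open>(ps ! j, q)\<close>
      would lie in \<open>C\<close>.\<close>
    then have "k \<noteq> j" using ik \<open>(ps, j, q) \<notin> H\<close> by (auto simp: H_def C_def)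
    assume "(ps, j, q) \<in> G"
    then show False using ik \<open>k \<noteq> j\<close> by (force simp: G_def)
  qed simp
  also have "\<dots> \<le> measure_pmf.prob RI (- G) + measure_pmf.prob RI H"
    by (intro measure_Un_le) auto
  also have "measure_pmf.prob RI (- G) = 1 - measure_pmf.prob RI G"
    using measure_pmf.prob_compl[of G RI] by (simp add: Compl_eq_Diff_UNIV)
  also have "measure_pmf.prob RI H = measure_pmf.prob NP C"
  proof -
    have "emeasure RI H = (\<integral>\<^sup>+ (ps, j, q). indicator C (ps ! j, q) \<partial>RI)"
    proof -
      have "emeasure RI H = (\<integral>\<^sup>+ z. indicator H z \<partial>RI)" by simp
      also have "\<dots> = (\<integral>\<^sup>+ (ps, j, q). indicator C (ps ! j, q) \<partial>RI)"
        by (intro nn_integral_cong) (auto simp: H_def indicator_def)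
      finally show ?thesis .
    qed
    also have "\<dots> = (\<integral>\<^sup>+ (x, q). indicator C (x, q) \<partial>NP)"
      unfolding RI_def NP_def
      by (rule nn_integral_random_instance_pair[where h = "\<lambda>x q. indicator C (x, q)"]) (use assms in auto)
    also have "\<dots> = emeasure NP C" by simp
    finally show ?thesis by (simp add: measure_def)
  qed
  also have "measure_pmf.prob NP C \<le> (\<Sum>i<m. measure_pmf.prob NP ((regions D ! i) \<times> {q. i \<in> probes D q}))"
    unfolding C_def by (intro measure_pmf.finite_measure_subadditive_finite) auto
  also have "\<dots> \<le> (\<Sum>i<m. region_density d D i powr (1 / p) * probe_density d D i powr (1 / q))"
    unfolding region_density_def probe_density_def NP_def
    using assms by (intro sum_mono noisy_pair_small_sets) (auto simp: field_simps)
  finally show ?thesis by (simp add: RI_def m_def)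
qed

text \<open>Weighted AM-GM, with terms normalized by the budgets \<open>X\<close> for the space and \<open>Y\<close> for the time.\<close>

lemma density_product_le:
  fixes a b n p q X Y :: real
  assumes "1 < p" "1 < q" "0 \<le> a" "0 \<le> b" "0 < n" "0 < X" "0 < Y"
  defines "K \<equiv> n powr (- 1 / p) * X powr (1 - 1 / q) * Y powr (1 / q)"
  shows "a powr (1 / p) * b powr (1 / q)
    \<le> K * ((1 - 1 / q) / X * (1 + n * a) + 1 / q / Y * (b * (1 + n * a)))"
proof (cases "b = 0")
  case True
  then show ?thesis using assms by (auto simp: K_def intro!: mult_nonneg_nonneg)
next
  case False
  define s where "s = 1 + n * a"
  have s: "1 \<le> s" using assms by (simp add: s_def)
  have "a \<le> s / n" using assms by (simp add: s_def field_simps)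
  then have "a powr (1 / p) \<le> (s / n) powr (1 / p)"
    using assms by (intro powr_mono2) auto
  also have "\<dots> = s powr (1 / p) * n powr (- 1 / p)"
    using assms by (simp add: powr_divide powr_minus field_simps)
  \<comment> \<open>As \<open>s \<ge> 1\<close>, the exponent can be raised to 1. Then
    \<open>s\<close> splits into \<open>s powr (1 - 1 / q)\<close> for the space and
    \<open>s powr (1 / q)\<close>, which joins \<open>b\<close> to form the time.\<close>
  also have "\<dots> \<le> s powr 1 * n powr (- 1 / p)"
    using s assms by (intro mult_right_mono powr_mono) auto
  finally have "a powr (1 / p) * b powr (1 / q) \<le> s * n powr (- 1 / p) * b powr (1 / q)"
    using s by (intro mult_right_mono) auto
  also have "\<dots> = n powr (- 1 / p) * (s powr (1 - 1 / q) * (b * s) powr (1 / q))"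
    using s by (simp add: powr_mult powr_diff)
  also have "\<dots> = K * ((s / X) powr (1 - 1 / q) * (b * s / Y) powr (1 / q))"
    using assms by (simp add: K_def powr_divide)
  also have "\<dots> \<le> K * ((1 - 1 / q) * (s / X) + 1 / q * (b * s / Y))"
    using assms s False by (intro mult_left_mono Youngs_inequality_0) (auto simp: K_def)
  finally show ?thesis by (simp add: s_def)
qed

text \<open>By the AM-GM bound, the success probability of a fixed structure is at most an affine
  function of its expected space and time. Affine bounds survive averaging over a random structure,
  and inserting the budgets leaves \<open>4 * K\<close>.\<close>

lemma success_prob_le:
  fixes p q c r X Y :: real and n d :: nat
  assumes pq: "1 < p" "1 < q" "(p - 1) * (q - 1) = (1 - 1 / c)\<^sup>2" "1 < c"
    and n: "2 \<le> n" "n \<le> 2 ^ d" and S: "set_pmf S \<subseteq> structures d"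
    and X: "0 < X" "expected_space S c n d \<le> ennreal X"
    and Y: "0 < Y" "expected_query_time S c n d \<le> ennreal Y"
  defines "G \<equiv> {(ps, j, q). \<forall>k<n. k \<noteq> j \<longrightarrow> l1_dist (ps ! k) q > c * r}"
    and "K \<equiv> real n powr (- 1 / p) * X powr (1 - 1 / q) * Y powr (1 / q)"
  shows "success_prob S c n d r \<le> (1 - measure_pmf.prob (random_instance c n d) G) + 4 * K"
proof -
  define RI where "RI = random_instance c n d"
  define \<beta> where "\<beta> = 1 - measure_pmf.prob RI G"
  define sp where "sp D = (\<integral>\<^sup>+ (ps, j, q). of_nat (total_space D (set ps)) \<partial>RI)" for D
  define tm where "tm D = (\<integral>\<^sup>+ (ps, j, q). of_nat (query_time D (set ps) q) \<partial>RI)" for D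
  have K: "0 \<le> K" by (simp add: K_def)
  have \<beta>: "0 \<le> \<beta>" by (simp add: \<beta>_def)
  \<comment> \<open>The AM-GM coefficients; the factor 4 offsets the 1/4 in the lower bounds for
    space and time.\<close>
  define u v where "u = 4 * K * ((1 - 1 / q) / X)" and "v = 4 * K * (1 / q / Y)"
  have uv: "0 \<le> u" "0 \<le> v" using K pq X Y by (auto simp: u_def v_def)
  have structure_bound: "emeasure RI {(ps, j, q). succeeds (c * r) D (set ps) q}
      \<le> ennreal \<beta> + (ennreal u * sp D + ennreal v * tm D)" if "D \<in> set_pmf S" for D
  proof -
    have D: "D \<in> structures d" using that S by auto
    define s t where "s i = (1 + real n * region_density d D i) / 4"
      and "t i = probe_density d D i * (1 + real n * region_density d D i) / 4" for i
    define m where "m = length (regions D)"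
    have st: "0 \<le> s i" "0 \<le> t i" for i by (auto simp: s_def t_def)
    have "measure_pmf.prob RI {(ps, j, q). succeeds (c * r) D (set ps) q}
        \<le> \<beta> + (\<Sum>i<m. region_density d D i powr (1 / p) * probe_density d D i powr (1 / q))"
      unfolding \<beta>_def RI_def m_def G_def
      by (rule success_prob_structure_le) (use pq n D in auto)
    also have "\<dots> \<le> \<beta> + (\<Sum>i<m. K * ((1 - 1 / q) / X * (1 + real n * region_density d D i) +
        1 / q / Y * (probe_density d D i * (1 + real n * region_density d D i))))"
      unfolding K_def using pq n X Y by (intro add_left_mono sum_mono density_product_le) auto
    also have "\<dots> = \<beta> + (\<Sum>i<m. u * s i + v * t i)"
    proof -
      have "K * ((1 - 1 / q) / X * a + 1 / q / Y * (b * a)) = u * (a / 4) + v * (b * a / 4)" for a b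
        by (simp add: u_def v_def distrib_left)
      then show ?thesis by (simp add: s_def t_def)
    qed
    also have "\<dots> = \<beta> + (u * (\<Sum>i<m. s i) + v * (\<Sum>i<m. t i))"
      by (simp only: sum_distrib_left sum.distrib)
    finally have "emeasure RI {(ps, j, q). succeeds (c * r) D (set ps) q}
        \<le> ennreal (\<beta> + (u * (\<Sum>i<m. s i) + v * (\<Sum>i<m. t i)))"
      by (simp add: measure_pmf.emeasure_eq_measure ennreal_leI)
    also have "\<dots> = ennreal \<beta> + (ennreal u * ennreal (\<Sum>i<m. s i) + ennreal v * ennreal (\<Sum>i<m. t i))"
      using \<beta> uv st by (simp add: ennreal_plus ennreal_mult sum_nonneg)
    also have "\<dots> \<le> ennreal \<beta> + (ennreal u * sp D + ennreal v * tm D)"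
      unfolding s_def t_def m_def sp_def tm_def RI_def
      by (intro add_left_mono add_mono mult_left_mono expected_total_space_ge expected_query_cost_ge n D) auto
    finally show ?thesis .
  qed
  have "ennreal (success_prob S c n d r) =
      emeasure (pair_pmf S RI) {(D, ps, j, q). succeeds (c * r) D (set ps) q}"
    by (simp add: success_prob_def measure_pmf.emeasure_eq_measure RI_def)
  also have "\<dots> = (\<integral>\<^sup>+ D. emeasure RI {(ps, j, q). succeeds (c * r) D (set ps) q} \<partial>S)"
    by (subst nn_integral_indicator[symmetric], simp)
      (auto simp: nn_integral_pair_pmf' simp flip: nn_integral_indicator
        intro!: nn_integral_cong split: split_indicator)
  also have "\<dots> \<le> (\<integral>\<^sup>+ D. ennreal \<beta> + (ennreal u * sp D + ennreal v * tm D) \<partial>S)"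
    by (intro nn_integral_mono_AE AE_pmfI structure_bound)
  also have "\<dots> = ennreal \<beta> + (ennreal u * expected_space S c n d + ennreal v * expected_query_time S c n d)"
    by (simp add: nn_integral_add nn_integral_cmult expected_space_def expected_query_time_def
        nn_integral_pair_pmf' sp_def tm_def RI_def)
  also have "\<dots> \<le> ennreal \<beta> + (ennreal u * ennreal X + ennreal v * ennreal Y)"
    using X Y by (intro add_left_mono add_mono mult_left_mono) auto
  also have "\<dots> = ennreal (\<beta> + (u * X + v * Y))"
    using \<beta> uv X Y by (simp add: ennreal_plus ennreal_mult)
  also have "u * X + v * Y = 4 * K"
  proof -
    have "u * X = 4 * K * (1 - 1 / q)" "v * Y = 4 * K * (1 / q)"
      using X Y by (simp_all add: u_def v_def)
    then show ?thesis by (simp add: right_diff_distrib)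
  qed
  finally have "success_prob S c n d r \<le> \<beta> + 4 * K"
    using \<beta> K by (subst (asm) ennreal_le_iff) auto
  then show ?thesis by (simp add: \<beta>_def RI_def)
qed

section \<open>Exponents\<close>

text \<open>Supplies a hypothesis of the sampling bounds. The constant \<open>1 / ln 2\<close> taken
  in the growth condition exchanges natural for binary logarithms.\<close>

lemma eventually_le_two_power:
  assumes "(\<lambda>n. real (d n)) \<in> \<omega>(\<lambda>n. ln (real n))"
  shows "\<forall>\<^sub>F n in sequentially. n \<le> 2 ^ d n"
  using landau_omega.smallD[OF assms, of "1 / ln 2", simplified] eventually_gt_at_top[of 0]
proof eventually_elim
  case (elim n)
  then have "ln (real n) \<le> real (d n) * ln 2"
    by (simp add: field_simps)
  then have "exp (ln (real n)) \<le> exp (real (d n) * ln 2)" by simp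
  then have "real n \<le> 2 powr real (d n)" using elim by (simp add: powr_def)
  then have "real n \<le> real (2 ^ d n)" by (simp add: powr_realpow)
  then show ?case by (simp only: of_nat_le_iff)
qed

text \<open>A negative limit would eventually put \<open>e n\<close> below \<open>L / 2 < 0\<close>,
  forcing the power below \<delta>.\<close>

lemma exponent_limit_nonneg:
  fixes e :: "nat \<Rightarrow> real"
  assumes "e \<longlonglongrightarrow> L" "\<forall>\<^sub>F n in sequentially. \<delta> \<le> real n powr e n" "0 < \<delta>"
  shows "0 \<le> L"
proof (rule ccontr)
  assume "\<not> 0 \<le> L"
  then have L: "L < L / 2" "L / 2 < 0" by auto
  have "((\<lambda>n. real n powr (L / 2)) \<longlongrightarrow> 0) sequentially"
    by (rule tendsto_neg_powr[OF L(2) filterlim_real_sequentially])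
  from order_tendstoD(2)[OF this \<open>0 < \<delta>\<close>] order_tendstoD(2)[OF assms(1) L(1)] assms(2) eventually_ge_at_top[of 1]
  have "\<forall>\<^sub>F n in sequentially. False"
  proof eventually_elim
    case (elim n)
    then have "real n powr e n \<le> real n powr (L / 2)" by (intro powr_mono) auto
    with elim show ?case by linarith
  qed
  then show False by simp
qed

text \<open>The left side of the tradeoff is positive, so \<open>y\<close> near 0 forces
  \<open>v \<ge> 0\<close> and large \<open>y\<close> forces \<open>u \<ge> 0\<close>; explicit
  witnesses replace these limits. For \<open>u = 0\<close> the bound comes from large
  \<open>y\<close>, otherwise from the best \<open>y\<close>.\<close>

lemma optimized_tradeoff:
  fixes \<sigma> u v :: real
  assumes \<sigma>: "0 < \<sigma>" "\<sigma> < 1"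
    and tradeoff: "\<And>y. 0 < y \<Longrightarrow> y * (1 - \<sigma>\<^sup>2) / (y + \<sigma>\<^sup>2) \<le> u * y + v"
  shows "sqrt (1 - \<sigma>\<^sup>2) \<le> sqrt v + \<sigma> * sqrt u"
proof -
  have \<sigma>2: "0 < 1 - \<sigma>\<^sup>2" "0 < \<sigma>\<^sup>2"
    using \<sigma> by (auto simp: abs_square_less_1)
  have pos: "0 < u * y + v" if "0 < y" for y
  proof -
    have "0 < y * (1 - \<sigma>\<^sup>2) / (y + \<sigma>\<^sup>2)"
      using that \<sigma>2 by (intro divide_pos_pos mult_pos_pos add_pos_pos)
    then show ?thesis using tradeoff[OF that] by linarith
  qed
  have v: "0 \<le> v"
  proof (rule ccontr)
    assume neg: "\<not> 0 \<le> v"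
    define y where "y = - v / (\<bar>u\<bar> + 1)"
    have y: "0 < y" unfolding y_def using neg by (intro divide_pos_pos) auto
    have "u * y \<le> (\<bar>u\<bar> + 1) * y" using y by (intro mult_right_mono) auto
    also have "\<dots> = - v" by (simp add: y_def)
    finally show False using pos[OF y] by simp
  qed
  have u: "0 \<le> u"
  proof (rule ccontr)
    assume neg: "\<not> 0 \<le> u"
    define y where "y = (v + 1) / (- u)"
    have "0 < y" unfolding y_def using neg v by (intro divide_pos_pos) auto
    moreover have "u * y + v = - 1" using neg by (simp add: y_def)
    ultimately show False using pos by force
  qed
  show ?thesis
  proof (cases "u = 0")
    case True
    have "1 - \<sigma>\<^sup>2 \<le> v"
    proof (rule ccontr)
      assume less: "\<not> 1 - \<sigma>\<^sup>2 \<le> v"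
      define k where "k = 1 - \<sigma>\<^sup>2 - v"
      \<comment> \<open>So large that \<open>k * y\<close> exceeds
        \<open>v * \<sigma>\<^sup>2\<close>, the most that the tradeoff permits.\<close>
      define y where "y = (v * \<sigma>\<^sup>2 + 1) / k"
      have k: "0 < k" using less by (simp add: k_def)
      then have y: "0 < y" using v \<sigma>2 by (auto simp: y_def intro!: divide_pos_pos add_nonneg_pos)
      have "y * (1 - \<sigma>\<^sup>2) \<le> v * (y + \<sigma>\<^sup>2)"
        using tradeoff[OF y] True y \<sigma>2 by (simp add: pos_divide_le_eq add_pos_pos)
      then have "k * y \<le> v * \<sigma>\<^sup>2" by (simp add: k_def algebra_simps)
      moreover have "k * y = v * \<sigma>\<^sup>2 + 1" using k by (simp add: y_def)
      ultimately show False by simp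
    qed
    then show ?thesis using True by simp
  next
    case False
    define w t where "w = sqrt u" and "t = sqrt (1 - \<sigma>\<^sup>2)"
    have wt: "0 < w" "w\<^sup>2 = u" "0 < t" "t\<^sup>2 = 1 - \<sigma>\<^sup>2"
      using u False \<sigma>2 by (auto simp: w_def t_def)
    have "t - \<sigma> * w \<le> sqrt v"
    proof (cases "t \<le> \<sigma> * w")
      case True
      then show ?thesis using v by (smt (verit) real_sqrt_ge_zero)
    next
      case less: False
      text \<open>The critical point of \<open>y (1 - \<sigma>\<^sup>2) / (y + \<sigma>\<^sup>2) - u y\<close>.\<close>
      define y where "y = \<sigma> * (t / w - \<sigma>)"
      have y: "0 < y" using less wt \<sigma> by (auto simp: y_def field_simps)
      have y\<sigma>: "y + \<sigma>\<^sup>2 = \<sigma> * t / w" by (simp add: y_def algebra_simps power2_eq_square)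
      have "y * (1 - \<sigma>\<^sup>2) / (y + \<sigma>\<^sup>2) = t\<^sup>2 - \<sigma> * t * w"
        unfolding y\<sigma> wt(4)[symmetric] using wt(1,3) \<sigma> by (simp add: y_def field_simps power2_eq_square)
      moreover have "u * y = \<sigma> * t * w - (\<sigma> * w)\<^sup>2"
        unfolding wt(2)[symmetric] using wt(1) by (simp add: y_def field_simps power2_eq_square)
      \<comment> \<open>At this \<open>y\<close> the tradeoff reads \<open>t\<^sup>2 - \<sigma> * t
        * w \<le> \<sigma> * t * w - (\<sigma> * w)\<^sup>2 + v\<close>, which completes a
        square.\<close>
      ultimately have "(t - \<sigma> * w)\<^sup>2 \<le> v"
        using tradeoff[OF y] by (simp add: power2_eq_square algebra_simps)
      then show ?thesis by (rule real_le_rsqrt)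
    qed
    then show ?thesis by (simp add: w_def t_def)
  qed
qed

theorem theorem4:
  fixes c \<rho>\<^sub>u \<rho>\<^sub>q :: real
    and d :: "nat \<Rightarrow> nat"
    and r \<epsilon>\<^sub>u \<epsilon>\<^sub>q :: "nat \<Rightarrow> real"
    and S :: "nat \<Rightarrow> list_of_points pmf"
  assumes c: "c > 1"
    and dim: "(\<lambda>n. real (d n)) \<in> \<omega>(\<lambda>n. ln (real n))"
    and radius: "instance_radius c d r"
    and struct: "\<And>n. set_pmf (S n) \<subseteq> structures (d n)"
    and o1: "\<epsilon>\<^sub>u \<in> o(\<lambda>_. 1)" "\<epsilon>\<^sub>q \<in> o(\<lambda>_. 1)"
    and space: "\<forall>\<^sub>F n in sequentially.
      expected_space (S n) c n (d n) \<le> ennreal (real n powr (1 + \<rho>\<^sub>u + \<epsilon>\<^sub>u n))"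
    and time: "\<forall>\<^sub>F n in sequentially.
      expected_query_time (S n) c n (d n) \<le> ennreal (real n powr (\<rho>\<^sub>q - \<epsilon>\<^sub>q n))"
    and success: "\<forall>\<^sub>F n in sequentially. success_prob (S n) c n (d n) (r n) \<ge> 2 / 3"
  shows "c * sqrt \<rho>\<^sub>q + (c - 1) * sqrt \<rho>\<^sub>u \<ge> sqrt (2 * c - 1)"
proof -
  define \<sigma> where "\<sigma> = 1 - 1 / c"
  have \<sigma>: "0 < \<sigma>" "\<sigma> < 1" using c by (auto simp: \<sigma>_def)
  have eps: "\<epsilon>\<^sub>u \<longlonglongrightarrow> 0" "\<epsilon>\<^sub>q \<longlonglongrightarrow> 0"
    using o1 by (auto dest!: smalloD_tendsto)
  have tradeoff: "y * (1 - \<sigma>\<^sup>2) / (y + \<sigma>\<^sup>2) \<le> \<rho>\<^sub>u * y + \<rho>\<^sub>q" if y: "y > 0" for y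
  proof -
    \<comment> \<open>\<open>y = q - 1\<close> is free, and the hypercontractive relation then fixes
      \<open>p\<close>.\<close>
    define p q where "p = 1 + \<sigma>\<^sup>2 / y" and "q = 1 + y"
    have pq: "1 < p" "1 < q" "(p - 1) * (q - 1) = (1 - 1 / c)\<^sup>2"
      using y \<sigma> by (auto simp: p_def q_def \<sigma>_def)
    define e where "e n = - 1 / p + (1 + \<rho>\<^sub>u + \<epsilon>\<^sub>u n) * (1 - 1 / q) + (\<rho>\<^sub>q - \<epsilon>\<^sub>q n) * (1 / q)" for n
    have lim: "e \<longlonglongrightarrow> - 1 / p + (1 + \<rho>\<^sub>u + 0) * (1 - 1 / q) + (\<rho>\<^sub>q - 0) * (1 / q)"
      unfolding e_def by (intro tendsto_intros eps)
    \<comment> \<open>Success at least 2/3 and failure of separation below 1/3 leave more than 1/3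
      for \<open>4 * real n powr e n\<close>.\<close>
    have low: "\<forall>\<^sub>F n in sequentially. 1 / 12 \<le> real n powr e n"
      using space time success eventually_ge_at_top[of 2] eventually_le_two_power[OF dim]
        order_tendstoD(1)[OF conjunct2[OF radius[unfolded instance_radius_def]], of "2 / 3", simplified]
    proof eventually_elim
      case (elim n)
      have "success_prob (S n) c n (d n) (r n) \<le>
          (1 - measure_pmf.prob (random_instance c n (d n))
            {(ps, j, q). \<forall>k<n. k \<noteq> j \<longrightarrow> l1_dist (ps ! k) q > c * r n}) +
          4 * (real n powr (- 1 / p) * (real n powr (1 + \<rho>\<^sub>u + \<epsilon>\<^sub>u n)) powr (1 - 1 / q) *
            (real n powr (\<rho>\<^sub>q - \<epsilon>\<^sub>q n)) powr (1 / q))"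
        by (rule success_prob_le) (use pq c elim struct in auto)
      also have "real n powr (- 1 / p) * (real n powr (1 + \<rho>\<^sub>u + \<epsilon>\<^sub>u n)) powr (1 - 1 / q) *
            (real n powr (\<rho>\<^sub>q - \<epsilon>\<^sub>q n)) powr (1 / q) = real n powr e n"
        by (simp only: e_def powr_powr powr_add[symmetric])
      finally show ?case using elim by linarith
    qed
    have "0 \<le> - 1 / p + (1 + \<rho>\<^sub>u + 0) * (1 - 1 / q) + (\<rho>\<^sub>q - 0) * (1 / q)"
      by (rule exponent_limit_nonneg[OF lim low]) simp
    then have "1 / p \<le> (1 + \<rho>\<^sub>u) * (1 - 1 / q) + \<rho>\<^sub>q * (1 / q)"
      by simp
    also have "1 / p = y / (y + \<sigma>\<^sup>2)" using y by (simp add: p_def field_simps)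
    also have "1 - 1 / q = y / (1 + y)" using y by (simp add: q_def field_simps)
    \<comment> \<open>Multiplying by \<open>1 + y = q\<close> clears the denominators on the
      right.\<close>
    finally have "(1 + y) * (y / (y + \<sigma>\<^sup>2)) \<le> (1 + y) * ((1 + \<rho>\<^sub>u) * (y / (1 + y)) + \<rho>\<^sub>q * (1 / q))"
      using y by (intro mult_left_mono) auto
    also have "\<dots> = (1 + \<rho>\<^sub>u) * y + \<rho>\<^sub>q"
    proof -
      have "z * (a * (y / z) + b * (1 / z)) = a * y + b" if "z \<noteq> 0" for a b z :: real
        using that by (simp add: distrib_left)
      then show ?thesis unfolding q_def using y by simp
    qed
    finally have "(1 + y) * (y / (y + \<sigma>\<^sup>2)) - y \<le> \<rho>\<^sub>u * y + \<rho>\<^sub>q"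
      by (simp add: algebra_simps)
    moreover have "y + \<sigma>\<^sup>2 \<noteq> 0" using y \<sigma> by (auto simp: add_nonneg_eq_0_iff)
    then have "(1 + y) * (y / (y + \<sigma>\<^sup>2)) - y = y * (1 - \<sigma>\<^sup>2) / (y + \<sigma>\<^sup>2)"
      by (simp add: field_simps)
    ultimately show ?thesis by simp
  qed
  \<comment> \<open>Multiplying by \<open>c\<close> produces the stated coefficients, since
    \<open>c * \<sigma> = c - 1\<close> and
    \<open>c\<^sup>2 * (1 - \<sigma>\<^sup>2) = 2 * c - 1\<close>.\<close>
  have "c * sqrt (1 - \<sigma>\<^sup>2) \<le> c * (sqrt \<rho>\<^sub>q + \<sigma> * sqrt \<rho>\<^sub>u)"
    using c \<sigma> tradeoff by (intro mult_left_mono optimized_tradeoff) auto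
  also have "\<dots> = c * sqrt \<rho>\<^sub>q + (c - 1) * sqrt \<rho>\<^sub>u"
    using c by (simp add: \<sigma>_def field_simps)
  also have "c * sqrt (1 - \<sigma>\<^sup>2) = sqrt (c\<^sup>2 * (1 - \<sigma>\<^sup>2))"
    using c by (simp add: real_sqrt_mult)
  also have "c\<^sup>2 * (1 - \<sigma>\<^sup>2) = 2 * c - 1"
    using c by (simp add: \<sigma>_def field_simps power2_eq_square)
  finally show ?thesis by simp
qed

end
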